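(* Let $s\ge 2$ be an integer, let $\lambda_s=\frac{\Gamma(1/s)^s}{s^s\, s!}$, and let $c$ be a real number with $c>\big(\lambda_s(1-2\lambda_s)\big)^{-1}$. Let $A$ be a random sequence of pseudo $s$-th powers. Then, almost surely, every sufficiently large integer $n$ can be written in the form $$n=a_1+\cdots+a_{s+1},\qquad a_i\in A,\qquad a_{s+1}<(c\log n)^s.$$
   Context: A random sequence of pseudo $s$-th powers is defined as follows (Erdős–Rényi model): on a probability space one takes independent Bernoulli random variables $(\xi_n)_{n\ge1}$ with $\mathbb P(\xi_n=1)=\frac1s n^{-1+1/s}$ and $\mathbb P(\xi_n=0)=1-\frac1s n^{-1+1/s}$, and sets $A=\{n\ge1:\xi_n=1\}$. Thus the events $\{n\in A\}$ are independent and $\mathbb P(n\in A)=\frac1s n^{-1+1/s}$. One has $\lambda_s<1/2$ for $s\ge2$. *)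

theory Defs
  imports "HOL-Probability.Probability"
begin

definition pseudo_power_lambda :: "nat \<Rightarrow> real" where
  "pseudo_power_lambda s = Gamma (1 / real s) ^ s / (real s ^ s * fact s)"

locale pseudo_powers = prob_space M for M :: "'w measure" +
  fixes s :: nat and xi :: "nat \<Rightarrow> 'w \<Rightarrow> real"
  assumes indep_xi: "indep_vars (\<lambda>_. borel) xi {1..}"
    and prob_xi_1: "\<And>n. n \<ge> 1 \<Longrightarrow>
      prob {\<omega> \<in> space M. xi n \<omega> = 1} = 1 / real s * real n powr (-1 + 1 / real s)"
    and prob_xi_0: "\<And>n. n \<ge> 1 \<Longrightarrow>
      prob {\<omega> \<in> space M. xi n \<omega> = 0} = 1 - 1 / real s * real n powr (-1 + 1 / real s)"

definition random_set :: "(nat \<Rightarrow> 'w \<Rightarrow> real) \<Rightarrow> 'w \<Rightarrow> nat set" where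
  "random_set xi \<omega> = {n. n \<ge> 1 \<and> xi n \<omega> = 1}"

end

theory Submission
  imports Defs "HOL-Combinatorics.Multiset_Permutations" "HOL-Real_Asymp.Real_Asymp"
begin

text \<open>
  Fix \<open>n\<close> and look at the pairs \<open>(b, X)\<close> with \<open>b < (c log n)^s\<close>, where \<open>X\<close> is a set of \<open>s\<close> integers,
  all at least \<open>\<delta> n\<close>, whose sum is \<open>n - b\<close>. Janson's inequality bounds the probability that no
  \<open>insert b X\<close> lies in the random set by \<open>exp (- \<mu> + \<Delta> / 2)\<close>.

  Let \<open>R\<close> be the expected number of sets \<open>X\<close> for a given \<open>b\<close>. To compute it, compare \<open>P(k \<in> A)\<close> with
  the coefficients of \<open>(1 - z)^(- 1/s)\<close>, which are asymptotic to \<open>k^(1/s - 1) / \<Gamma>(1/s)\<close>. The \<open>s\<close>-th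
  power of this series is \<open>1 / (1 - z)\<close>, so its \<open>s\<close>-fold convolutions are exactly \<open>1\<close> and \<open>R\<close> is
  close to \<open>\<lambda>\<^sub>s\<close>; the restriction to summands at least \<open>\<delta> n\<close> loses a fraction \<open>O(\<delta>^(1/s))\<close>.

  Since the \<open>b\<close> contribute \<open>c log n - O(1)\<close> in expectation, \<open>\<mu>\<close> is about \<open>\<lambda>\<^sub>s c log n\<close>. In \<open>\<Delta>\<close> the
  pairs with the same \<open>b\<close> and disjoint \<open>X\<close> contribute about \<open>\<lambda>\<^sub>s\<^sup>2 c log n\<close>, and those with overlapping
  \<open>X\<close> only \<open>O((log n)^(2 s) n^(- 1/s))\<close>. The failure probability is thus
  \<open>O(n^(- c (\<lambda>\<^sub>s - \<lambda>\<^sub>s\<^sup>2 / 2) + o(1)))\<close>, which is summable, and Borel--Cantelli applies.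
\<close>

unbundle no vec_syntax
unbundle fps_syntax

subsection \<open>Janson's inequality\<close>

lemma (in prob_space) prob_Inter_indep_events:
  assumes "indep_events E S" "finite I" "I \<subseteq> S"
  shows "prob {\<omega>\<in>space M. \<forall>i\<in>I. \<omega> \<in> E i} = (\<Prod>i\<in>I. prob (E i))"
proof (cases "I = {}")
  case True
  then show ?thesis by (simp add: prob_space)
next
  case False
  have "E i \<subseteq> space M" if "i \<in> I" for i
    using that assms by (intro sets.sets_into_space) (auto simp: indep_events_def)
  then have "{\<omega>\<in>space M. \<forall>i\<in>I. \<omega> \<in> E i} = (\<Inter>i\<in>I. E i)"
    using False by blast
  then show ?thesis using assms False by (simp add: indep_events_def)
qed

lemma (in prob_space) events_Ball_not_Ball:
  assumes "indep_events E S" "finite K" "finite I" "I \<subseteq> S"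
    and "\<And>k. k \<in> K \<Longrightarrow> finite (T k) \<and> T k \<subseteq> S"
  shows "{\<omega>\<in>space M. (\<forall>i\<in>I. \<omega> \<in> E i) \<and> (\<forall>k\<in>K. \<not> (\<forall>i\<in>T k. \<omega> \<in> E i))} \<in> events"
proof -
  have *: "{\<omega>\<in>space M. \<forall>i\<in>J. \<omega> \<in> E i} \<in> events" if "finite J" "J \<subseteq> S" for J
  proof (rule sets.sets_Collect_finite_All[OF _ that(1)])
    fix i assume "i \<in> J"
    then have "E i \<in> events" using assms(1) that by (auto simp: indep_events_def)
    then show "{\<omega>\<in>space M. \<omega> \<in> E i} \<in> events" by (simp add: Collect_conj_eq)
  qed
  have "{\<omega>\<in>space M. \<forall>k\<in>K. \<not> (\<forall>i\<in>T k. \<omega> \<in> E i)} \<in> events"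
    using assms(5) by (intro sets.sets_Collect_finite_All[OF _ assms(2)] sets.sets_Collect_neg *) auto
  then show ?thesis using *[OF assms(3,4)] by (intro sets.sets_Collect_conj)
qed

text \<open>The two conditions concern disjoint sets of indices. Instead of generated
  sigma-algebras, the proof uses induction on \<open>K\<close> with inclusion-exclusion;
  \<open>I\<close> and \<open>T\<close> must vary because each step enlarges \<open>I\<close> by
  \<open>T k\<close> and shrinks every other \<open>T j\<close>.\<close>

lemma (in prob_space) prob_Ball_not_Ball_indep:
  assumes "indep_events E S" "finite K" "finite I" "I \<subseteq> S"
    and "\<And>k. k \<in> K \<Longrightarrow> finite (T k) \<and> T k \<subseteq> S \<and> T k \<inter> I = {}"
  shows "prob {\<omega>\<in>space M. (\<forall>i\<in>I. \<omega> \<in> E i) \<and> (\<forall>k\<in>K. \<not> (\<forall>i\<in>T k. \<omega> \<in> E i))} =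
         (\<Prod>i\<in>I. prob (E i)) * prob {\<omega>\<in>space M. \<forall>k\<in>K. \<not> (\<forall>i\<in>T k. \<omega> \<in> E i)}"
  using assms(2-5)
proof (induction K arbitrary: I T rule: finite_induct)
  case empty
  then show ?case using prob_Inter_indep_events[OF assms(1)] by (simp add: prob_space)
next
  case (insert k K)
  define D where "D I T = {\<omega>\<in>space M. (\<forall>i\<in>I. \<omega> \<in> E i) \<and> (\<forall>k\<in>K. \<not> (\<forall>i\<in>T k. \<omega> \<in> E i))}"
    for I and T :: "'c \<Rightarrow> 'b set"
  have D_events: "D I T' \<in> events" if "finite I" "I \<subseteq> S" "\<And>k. k \<in> K \<Longrightarrow> finite (T' k) \<and> T' k \<subseteq> S" for I T'
    unfolding D_def using that by (intro events_Ball_not_Ball[OF assms(1) insert.hyps(1)])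
  let ?T' = "\<lambda>j. T j - T k"
  have k: "finite (T k)" "T k \<subseteq> S" "T k \<inter> I = {}" using insert.prems(3) by auto
  have T: "finite (T j) \<and> T j \<subseteq> S \<and> T j \<inter> I = {}" if "j \<in> K" for j using insert.prems(3) that by auto
  \<comment> \<open>Avoiding \<open>T k\<close> as well removes the part where all of
    \<open>T k\<close> occurs. On that part avoiding \<open>T j\<close> means avoiding
    \<open>T j - T k\<close>, which is disjoint from \<open>J \<union> T k\<close>, so the induction
    hypothesis covers both terms.\<close>
  have split: "prob {\<omega>\<in>space M. (\<forall>i\<in>J. \<omega> \<in> E i) \<and> (\<forall>k\<in>insert k K. \<not> (\<forall>i\<in>T k. \<omega> \<in> E i))}
       = prob (D J T) - prob (D (J \<union> T k) ?T')" if "J \<subseteq> S" "finite J" for J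
  proof -
    have "{\<omega>\<in>space M. (\<forall>i\<in>J. \<omega> \<in> E i) \<and> (\<forall>k\<in>insert k K. \<not> (\<forall>i\<in>T k. \<omega> \<in> E i))}
        = D J T - D (J \<union> T k) ?T'"
      unfolding D_def by blast
    moreover have "D (J \<union> T k) ?T' \<subseteq> D J T" by (auto simp: D_def)
    moreover have "D J T \<in> events" "D (J \<union> T k) ?T' \<in> events" using that k
      by (auto intro!: D_events dest: T)
    ultimately show ?thesis by (simp add: finite_measure_Diff)
  qed
  have IH: "prob (D J T') = (\<Prod>i\<in>J. prob (E i)) * prob (D {} T')"
    if "finite J" "J \<subseteq> S" "\<And>k. k \<in> K \<Longrightarrow> finite (T' k) \<and> T' k \<subseteq> S \<and> T' k \<inter> J = {}" for J T'
    using insert.IH[OF that] by (simp add: D_def)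
  have 1: "prob (D I T) = (\<Prod>i\<in>I. prob (E i)) * prob (D {} T)"
    using insert.prems T by (intro IH) auto
  have 2: "prob (D (I \<union> T k) ?T') = (\<Prod>i\<in>I \<union> T k. prob (E i)) * prob (D {} ?T')"
    using insert.prems T k by (intro IH) auto
  have 3: "prob (D ({} \<union> T k) ?T') = (\<Prod>i\<in>T k. prob (E i)) * prob (D {} ?T')"
    using insert.prems T k IH[of "T k" ?T'] by auto
  have 4: "(\<Prod>i\<in>I \<union> T k. prob (E i)) = (\<Prod>i\<in>I. prob (E i)) * (\<Prod>i\<in>T k. prob (E i))"
    using k insert.prems by (intro prod.union_disjoint) auto
  have "prob {\<omega>\<in>space M. \<forall>k\<in>insert k K. \<not> (\<forall>i\<in>T k. \<omega> \<in> E i)} =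
      prob (D {} T) - (\<Prod>i\<in>T k. prob (E i)) * prob (D {} ?T')"
    using split[of "{}"] unfolding 3 by simp
  then show ?case unfolding split[OF insert.prems(2,1)] 1 2 4 by (simp only: right_diff_distrib mult.assoc)
qed

text \<open>The special case of Harris' inequality needed for Janson's: given that the events in \<open>I\<close> occur,
  avoiding \<open>T k\<close> means avoiding the smaller set \<open>T k - I\<close>, which is independent of \<open>I\<close>.\<close>

lemma (in prob_space) prob_Ball_not_Ball_le:
  assumes "indep_events E S" "finite K" "finite I" "I \<subseteq> S"
    and "\<And>k. k \<in> K \<Longrightarrow> finite (T k) \<and> T k \<subseteq> S"
  shows "prob {\<omega>\<in>space M. (\<forall>i\<in>I. \<omega> \<in> E i) \<and> (\<forall>k\<in>K. \<not> (\<forall>i\<in>T k. \<omega> \<in> E i))} \<le>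
         (\<Prod>i\<in>I. prob (E i)) * prob {\<omega>\<in>space M. \<forall>k\<in>K. \<not> (\<forall>i\<in>T k. \<omega> \<in> E i)}"
proof -
  have "{\<omega>\<in>space M. (\<forall>i\<in>I. \<omega> \<in> E i) \<and> (\<forall>k\<in>K. \<not> (\<forall>i\<in>T k. \<omega> \<in> E i))} =
        {\<omega>\<in>space M. (\<forall>i\<in>I. \<omega> \<in> E i) \<and> (\<forall>k\<in>K. \<not> (\<forall>i\<in>T k - I. \<omega> \<in> E i))}" by blast
  also have "prob \<dots> = (\<Prod>i\<in>I. prob (E i)) * prob {\<omega>\<in>space M. \<forall>k\<in>K. \<not> (\<forall>i\<in>T k - I. \<omega> \<in> E i)}"
    using assms(5) by (intro prob_Ball_not_Ball_indep[OF assms(1-4)]) auto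
  also have "\<dots> \<le> (\<Prod>i\<in>I. prob (E i)) * prob {\<omega>\<in>space M. \<forall>k\<in>K. \<not> (\<forall>i\<in>T k. \<omega> \<in> E i)}"
    using assms
      events_Ball_not_Ball[OF assms(1,2), of "{}" T]
    by (intro mult_left_mono finite_measure_mono prod_nonneg) auto
  finally show ?thesis .
qed

text \<open>Induction on \<open>K\<close>: the chance of avoiding everything shrinks by a factor of
  at most \<open>exp (- q)\<close> for each new \<open>k\<close>, where \<open>q\<close> is the
  weight of \<open>T k\<close> minus the weights of its unions with the neighbours, that is, the
  earlier sets meeting it. The double sum runs over ordered pairs, hence the division by 2.\<close>

theorem (in prob_space) Janson_inequality:
  assumes "indep_events E S" "finite K"
    and "\<And>k. k \<in> K \<Longrightarrow> finite (T k) \<and> T k \<subseteq> S"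
  defines "w \<equiv> \<lambda>I. \<Prod>i\<in>I. prob (E i)"
  shows "prob {\<omega>\<in>space M. \<forall>k\<in>K. \<not> (\<forall>i\<in>T k. \<omega> \<in> E i)} \<le>
    exp (- (\<Sum>k\<in>K. w (T k)) +
      (\<Sum>k\<in>K. \<Sum>l | l \<in> K \<and> l \<noteq> k \<and> T k \<inter> T l \<noteq> {}. w (T k \<union> T l)) / 2)"
  using assms(2,3)
proof (induction K rule: finite_induct)
  case empty
  then show ?case by (simp add: prob_space)
next
  case (insert k K)
  define N where "N = {l\<in>K. T k \<inter> T l \<noteq> {}}"
  define P where "P = (\<lambda>I K. {\<omega>\<in>space M. (\<forall>i\<in>I. \<omega> \<in> E i) \<and> (\<forall>k\<in>K. \<not> (\<forall>i\<in>T k. \<omega> \<in> E i))})"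
  define q where "q = w (T k) - (\<Sum>l\<in>N. w (T k \<union> T l))"
  have N: "finite N" "N \<subseteq> K" using insert by (auto simp: N_def)
  have T: "finite (T j) \<and> T j \<subseteq> S" if "j \<in> insert k K" for j using insert.prems that by auto
  have P_events: "P I L \<in> events" if "finite I" "I \<subseteq> S" "L \<subseteq> K" for I L
    unfolding P_def using that T finite_subset[OF that(3) insert.hyps(1)]
    by (intro events_Ball_not_Ball[OF assms(1)]) auto
  have main: "q * prob (P {} (K - N)) \<le> prob (P (T k) K)"
  proof -
    \<comment> \<open>If \<open>T k\<close> occurs and all non-neighbours are avoided, then either
      all of \<open>K\<close> is avoided or some neighbour occurs together with
      \<open>T k\<close>.\<close>
    have "P (T k) (K - N) \<subseteq> P (T k) K \<union> (\<Union>l\<in>N. P (T k \<union> T l) (K - N))"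
      unfolding P_def by blast
    then have "prob (P (T k) (K - N)) \<le> prob (P (T k) K \<union> (\<Union>l\<in>N. P (T k \<union> T l) (K - N)))"
      using T N by (intro finite_measure_mono sets.Un P_events sets.finite_UN) auto
    also have "\<dots> \<le> prob (P (T k) K) + prob (\<Union>l\<in>N. P (T k \<union> T l) (K - N))"
      using T N by (intro measure_Un_le P_events sets.finite_UN) auto
    also have "prob (\<Union>l\<in>N. P (T k \<union> T l) (K - N)) \<le> (\<Sum>l\<in>N. prob (P (T k \<union> T l) (K - N)))"
      using T N by (intro finite_measure_subadditive_finite) (auto intro!: P_events)
    also have "\<dots> \<le> (\<Sum>l\<in>N. w (T k \<union> T l) * prob (P {} (K - N)))"
    proof (rule sum_mono)
      fix l assume "l \<in> N"
      then show "prob (P (T k \<union> T l) (K - N)) \<le> w (T k \<union> T l) * prob (P {} (K - N))"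
        using T N insert.hyps prob_Ball_not_Ball_le[OF assms(1), of "K - N" "T k \<union> T l" T]
        by (auto simp: P_def w_def)
    qed
    finally have "prob (P (T k) (K - N)) \<le>
        prob (P (T k) K) + (\<Sum>l\<in>N. w (T k \<union> T l)) * prob (P {} (K - N))"
      by (simp add: sum_distrib_right)
    \<comment> \<open>The non-neighbours are disjoint from \<open>T k\<close>, so this is an
      equality. The union \<open>T k \<union> T l\<close> may meet them, so Harris' inequality was
      needed above.\<close>
    moreover have "prob (P (T k) (K - N)) = w (T k) * prob (P {} (K - N))"
      using T N insert.hyps prob_Ball_not_Ball_indep[OF assms(1), of "K - N" "T k" T]
      by (auto simp: P_def w_def N_def)
    ultimately show ?thesis by (simp add: q_def algebra_simps)
  qed
  have "prob (P {} (insert k K)) = prob (P {} K - P (T k) K)"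
    by (rule arg_cong[where f=prob]) (auto simp: P_def)
  also have "\<dots> = prob (P {} K) - prob (P (T k) K)"
    using T by (intro finite_measure_Diff P_events) (auto simp: P_def)
  also have "\<dots> \<le> exp (- q) * prob (P {} K)"
  \<comment> \<open>For negative \<open>q\<close> the estimate \<open>main\<close> says nothing, but
    then \<open>exp (- q)\<close> exceeds 1 and the claim is trivial.\<close>
  proof (cases "q \<ge> 0")
    case True
    have "prob (P {} K) \<le> prob (P {} (K - N))"
      by (intro finite_measure_mono P_events) (auto simp: P_def)
    then have "q * prob (P {} K) \<le> q * prob (P {} (K - N))" using True by (rule mult_left_mono)
    then have "prob (P {} K) - prob (P (T k) K) \<le> (1 - q) * prob (P {} K)"
      using main by (simp add: algebra_simps)
    also have "\<dots> \<le> exp (- q) * prob (P {} K)"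
      using exp_ge_add_one_self[of "-q"] by (intro mult_right_mono) auto
    finally show ?thesis .
  next
    case False
    then have "1 * prob (P {} K) \<le> exp (- q) * prob (P {} K)" by (intro mult_right_mono) auto
    then show ?thesis using measure_nonneg[of M "P (T k) K"] by linarith
  qed
  also have "\<dots> \<le> exp (- q) * exp (- (\<Sum>k\<in>K. w (T k)) +
      (\<Sum>k\<in>K. \<Sum>l | l \<in> K \<and> l \<noteq> k \<and> T k \<inter> T l \<noteq> {}. w (T k \<union> T l)) / 2)"
    using insert.IH insert.prems by (intro mult_left_mono) (auto simp: P_def)
  also have "\<dots> = exp (- (\<Sum>k\<in>insert k K. w (T k)) + (\<Sum>k'\<in>insert k K.
      \<Sum>l | l \<in> insert k K \<and> l \<noteq> k' \<and> T k' \<inter> T l \<noteq> {}. w (T k' \<union> T l)) / 2)"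
  proof -
    \<comment> \<open>Adding \<open>k\<close> creates each neighbouring pair twice, as (k, l) and as
      (l, k); halving leaves exactly the sum subtracted in \<open>q\<close>.\<close>
    have 1: "{l. l \<in> insert k K \<and> l \<noteq> k \<and> T k \<inter> T l \<noteq> {}} = N"
      using insert.hyps by (auto simp: N_def)
    have 2: "(\<Sum>l | l \<in> insert k K \<and> l \<noteq> j \<and> T j \<inter> T l \<noteq> {}. w (T j \<union> T l)) =
        (if j \<in> N then w (T k \<union> T j) else 0) +
        (\<Sum>l | l \<in> K \<and> l \<noteq> j \<and> T j \<inter> T l \<noteq> {}. w (T j \<union> T l))" if "j \<in> K" for j
    proof (cases "j \<in> N")
      case True
      have "{l. l \<in> insert k K \<and> l \<noteq> j \<and> T j \<inter> T l \<noteq> {}} =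
            insert k {l. l \<in> K \<and> l \<noteq> j \<and> T j \<inter> T l \<noteq> {}}"
        using True that insert.hyps by (auto simp: N_def)
      then show ?thesis using True insert.hyps by (simp add: Un_commute)
    next
      case False
      then have "{l. l \<in> insert k K \<and> l \<noteq> j \<and> T j \<inter> T l \<noteq> {}} =
            {l. l \<in> K \<and> l \<noteq> j \<and> T j \<inter> T l \<noteq> {}}"
        using that by (auto simp: N_def)
      then show ?thesis using False by simp
    qed
    have 3: "(\<Sum>j\<in>K. if j \<in> N then w (T k \<union> T j) else 0) = (\<Sum>l\<in>N. w (T k \<union> T l))"
      using insert.hyps N by (simp add: sum.If_cases Int_absorb1)
    define f where "f = (\<lambda>j. \<Sum>l | l \<in> insert k K \<and> l \<noteq> j \<and> T j \<inter> T l \<noteq> {}. w (T j \<union> T l))"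
    have "(\<Sum>j\<in>insert k K. f j) = f k + (\<Sum>j\<in>K. f j)"
      using insert.hyps by simp
    also have "(\<Sum>j\<in>K. f j) = (\<Sum>j\<in>K. (if j \<in> N then w (T k \<union> T j) else 0) +
        (\<Sum>l | l \<in> K \<and> l \<noteq> j \<and> T j \<inter> T l \<noteq> {}. w (T j \<union> T l)))"
      unfolding f_def by (rule sum.cong[OF refl 2])
    also have "f k = (\<Sum>l\<in>N. w (T k \<union> T l))"
      by (simp only: f_def 1)
    finally show ?thesis
      using insert.hyps unfolding f_def
      by (simp add: sum.distrib 3 q_def exp_add[symmetric] field_simps)
  qed
  finally show ?case by (simp add: P_def)
qed

subsection \<open>Convolution powers of the negative binomial series\<close>

text \<open>The expansion of \<open>(1 - z)^(- a)\<close>.\<close>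

definition neg_binomial_series :: "real \<Rightarrow> real fps" where
  "neg_binomial_series a = Abs_fps (\<lambda>n. pochhammer a n / fact n)"

lemma neg_binomial_series_nonneg: "a \<ge> 0 \<Longrightarrow> neg_binomial_series a $ n \<ge> 0"
  by (cases "a = 0") (auto simp: neg_binomial_series_def pochhammer_nonneg pochhammer_0_left)

lemma neg_binomial_series_pos: "a > 0 \<Longrightarrow> neg_binomial_series a $ n > 0"
  by (simp add: neg_binomial_series_def pochhammer_pos)

lemma neg_binomial_series_mult:
  "neg_binomial_series a * neg_binomial_series b = neg_binomial_series (a + b)"
proof (rule fps_ext)
  fix n
  have "(neg_binomial_series a * neg_binomial_series b) $ n =
      (\<Sum>k\<le>n. pochhammer a k * pochhammer b (n - k) / (fact k * fact (n - k)))"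
    by (simp add: fps_mult_nth neg_binomial_series_def atLeast0AtMost)
  also have "\<dots> = (\<Sum>k\<le>n. of_nat (n choose k) * pochhammer a k * pochhammer b (n - k) / fact n)"
    by (intro sum.cong) (simp_all add: binomial_fact)
  also have "\<dots> = neg_binomial_series (a + b) $ n"
    by (simp add: pochhammer_binomial_sum sum_divide_distrib neg_binomial_series_def)
  finally show "(neg_binomial_series a * neg_binomial_series b) $ n = neg_binomial_series (a + b) $ n" .
qed

lemma neg_binomial_series_power:
  "neg_binomial_series a ^ k = neg_binomial_series (real k * a)"
proof (induction k)
  case 0
  show ?case by (rule fps_ext) (auto simp: neg_binomial_series_def pochhammer_0_left)
next
  case (Suc k)
  then show ?case by (simp add: neg_binomial_series_mult algebra_simps)
qed

lemma neg_binomial_series_one_nth [simp]: "neg_binomial_series 1 $ n = 1"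
  by (simp add: neg_binomial_series_def pochhammer_fact[symmetric])

text \<open>Multiplication by the all-ones series \<open>neg_binomial_series 1\<close> forms partial
  sums.\<close>

lemma neg_binomial_series_partial_sum:
  "(\<Sum>k\<le>n. neg_binomial_series a $ k) = neg_binomial_series (a + 1) $ n"
  by (simp add: neg_binomial_series_mult[symmetric] fps_mult_nth atLeast0AtMost)

lemma neg_binomial_series_asymptotic:
  "(\<lambda>n. neg_binomial_series a $ n / real n powr (a - 1)) \<longlonglongrightarrow> inverse (Gamma a)"
proof -
  have "(\<lambda>n. ((-a) gchoose n) / ((-1)^n / exp ((-a+1) * ln (real n)))) \<longlonglongrightarrow> inverse (Gamma a)"
    using gbinomial_asymptotic[of "-a"] by simp
  moreover have "\<forall>\<^sub>F n in sequentially. ((-a) gchoose n) / ((-1)^n / exp ((-a+1) * ln (real n))) =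
      neg_binomial_series a $ n / real n powr (a - 1)"
    using eventually_gt_at_top[of 0]
  proof eventually_elim
    case (elim n)
    have "exp ((-a+1) * ln (real n)) = inverse (real n powr (a - 1))"
      using elim by (simp add: powr_def exp_minus[symmetric] algebra_simps)
    then show ?case
      by (simp add: gbinomial_pochhammer neg_binomial_series_def field_simps power_mult_distrib[symmetric])
  qed
  ultimately show ?thesis by (rule Lim_transform_eventually)
qed

lemma neg_binomial_series_bound:
  "\<exists>C>0. \<forall>n\<ge>1. neg_binomial_series a $ n \<le> C * real n powr (a - 1)"
proof -
  have "Bseq (\<lambda>n. neg_binomial_series a $ n / real n powr (a - 1))"
    using neg_binomial_series_asymptotic by (intro convergent_imp_Bseq convergentI)
  then obtain C where C: "C > 0" "\<And>n. norm (neg_binomial_series a $ n / real n powr (a - 1)) \<le> C"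
    by (rule BseqE) auto
  have "neg_binomial_series a $ n \<le> C * real n powr (a - 1)" if "n \<ge> 1" for n
    using C(2)[of n] that by (auto simp: abs_le_iff pos_divide_le_eq)
  then show ?thesis using C by blast
qed

section \<open>Coefficientwise inequalities and truncation of power series\<close>

lemma fps_mult_mono_nth:
  fixes f g h k :: "real fps"
  assumes "\<And>n. 0 \<le> f $ n" "\<And>n. f $ n \<le> g $ n" "\<And>n. 0 \<le> h $ n" "\<And>n. h $ n \<le> k $ n"
  shows "(f * h) $ n \<le> (g * k) $ n"
  unfolding fps_mult_nth
  by (intro sum_mono mult_mono assms order.trans[OF assms(1) assms(2)])

lemma fps_mult_nonneg_nth:
  fixes f g :: "real fps"
  assumes "\<And>n. 0 \<le> f $ n" "\<And>n. 0 \<le> g $ n"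
  shows "0 \<le> (f * g) $ n"
  unfolding fps_mult_nth by (intro sum_nonneg mult_nonneg_nonneg assms)

lemma fps_power_nonneg_nth:
  fixes f :: "real fps"
  assumes "\<And>n. 0 \<le> f $ n"
  shows "0 \<le> (f ^ k) $ n"
proof (induction k arbitrary: n)
  case (Suc k)
  then show ?case by (auto intro!: fps_mult_nonneg_nth assms)
qed auto

lemma fps_power_mono_nth:
  fixes f g :: "real fps"
  assumes "\<And>n. 0 \<le> f $ n" "\<And>n. f $ n \<le> g $ n"
  shows "(f ^ k) $ n \<le> (g ^ k) $ n"
proof (induction k arbitrary: n)
  case (Suc k)
  then show ?case by (auto intro!: fps_mult_mono_nth assms fps_power_nonneg_nth)
qed auto

text \<open>The difference of the two powers is \<open>u\<close> times \<open>Suc k\<close> products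
  of \<open>k\<close> factors, each factor \<open>v\<close> or \<open>u + v\<close>, and each
  product is dominated by \<open>(u + v) ^ k\<close>. It measures what is lost when the low-order
  part \<open>u\<close> is dropped.\<close>

lemma fps_power_add_le_nth:
  fixes u v :: "real fps"
  assumes u: "\<And>n. 0 \<le> u $ n" and v: "\<And>n. 0 \<le> v $ n"
  shows "((u + v) ^ Suc k) $ n \<le> (v ^ Suc k) $ n + real (Suc k) * (u * (u + v) ^ k) $ n"
proof (induction k arbitrary: n)
  case (Suc k)
  let ?c = "fps_const (real (Suc k))"
  have "((u + v) * (u + v) ^ Suc k) $ n \<le> ((u + v) * (v ^ Suc k + ?c * (u * (u + v) ^ k))) $ n"
    using Suc u v by (intro fps_mult_mono_nth fps_power_nonneg_nth) auto
  also have "(u + v) * (v ^ Suc k + ?c * (u * (u + v) ^ k)) =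
      v ^ Suc (Suc k) + u * v ^ Suc k + ?c * (u * (u + v) ^ Suc k)"
    by (simp add: algebra_simps)
  also have "\<dots> $ n = (v ^ Suc (Suc k)) $ n + (u * v ^ Suc k) $ n + real (Suc k) * (u * (u + v) ^ Suc k) $ n"
    by simp
  also have "(u * v ^ Suc k) $ n \<le> (u * (u + v) ^ Suc k) $ n"
    using u v by (intro fps_mult_mono_nth fps_power_nonneg_nth fps_power_mono_nth) auto
  finally show ?case by (simp add: algebra_simps)
qed auto

text \<open>Without truncation every coefficient of the power is 1. Dropping the terms below
  \<open>T\<close> costs at most s times the m-th coefficient of \<open>u T * H\<close>, where
  \<open>H\<close> is the (s-1)-st power of the full series. The coefficients of \<open>u T\<close>
  add up to O(T^(1/s)), and those of \<open>H\<close> at the indices involved, all at least m - T,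
  are O((m-T)^(-1/s)).\<close>

lemma neg_binomial_series_tail_power:
  assumes "s \<ge> 2"
  defines "v \<equiv> \<lambda>T. neg_binomial_series (1 / real s) - fps_cutoff T (neg_binomial_series (1 / real s))"
  shows "\<exists>C>0. \<forall>T m. 1 \<le> T \<longrightarrow> T < m \<longrightarrow>
           1 - C * (real T / real (m - T)) powr (1 / real s) \<le> (v T ^ s) $ m"
    and "(v T ^ s) $ m \<le> 1"
proof -
  define G where "G = neg_binomial_series (1 / real s)"
  define u where "u = (\<lambda>T. fps_cutoff T G)"
  have G: "G $ n \<ge> 0" for n by (simp add: G_def neg_binomial_series_nonneg)
  have Gs: "(G ^ s) $ n = 1" for n using assms by (simp add: G_def neg_binomial_series_power)
  have uv: "u T + v T = G" for T by (simp add: u_def v_def G_def)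
  have u: "u T $ n \<ge> 0" for T n using G by (simp add: u_def)
  have v: "v T $ n \<ge> 0" "v T $ n \<le> G $ n" for T n using G by (auto simp: v_def G_def[symmetric])
  show "(v T ^ s) $ m \<le> 1" using fps_power_mono_nth[of "v T" G] v by (metis Gs)
  define H where "H = G ^ (s - 1)"
  have H: "H = neg_binomial_series (1 - 1 / real s)"
    using assms by (simp add: H_def G_def neg_binomial_series_power field_simps of_nat_diff)
  obtain C1 where C1: "C1 > 0" "\<And>n. n \<ge> 1 \<Longrightarrow> H $ n \<le> C1 * real n powr (- 1 / real s)"
    using neg_binomial_series_bound[of "1 - 1 / real s"] by (auto simp: H)
  obtain C2 where C2: "C2 > 0"
      "\<And>n. n \<ge> 1 \<Longrightarrow> neg_binomial_series (1 / real s + 1) $ n \<le> C2 * real n powr (1 / real s)"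
    using neg_binomial_series_bound[of "1 / real s + 1"] by auto
  have bd: "(u T * H) $ m \<le> C1 * C2 * (real T / real (m - T)) powr (1 / real s)"
    if "1 \<le> T" "T < m" for T m
  proof -
    have "(u T * H) $ m = (\<Sum>i=0..m. if i < T then G $ i * H $ (m - i) else 0)"
      unfolding fps_mult_nth by (intro sum.cong) (auto simp: u_def)
    also have "\<dots> = (\<Sum>i<T. G $ i * H $ (m - i))"
      using that by (subst sum.inter_filter[symmetric]) (auto intro!: sum.cong)
    also have "\<dots> \<le> (\<Sum>i<T. G $ i * (C1 * real (m - T) powr (- 1 / real s)))"
    proof (intro sum_mono mult_left_mono G)
      fix i assume i: "i \<in> {..<T}"
      have "H $ (m - i) \<le> C1 * real (m - i) powr (- 1 / real s)" using i that by (intro C1) auto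
      also have "real (m - i) powr (- 1 / real s) \<le> real (m - T) powr (- 1 / real s)"
        using i that by (intro powr_mono2') auto
      finally show "H $ (m - i) \<le> C1 * real (m - T) powr (- 1 / real s)" using C1(1) by auto
    qed
    also have "\<dots> = (\<Sum>i<T. G $ i) * (C1 * real (m - T) powr (- 1 / real s))"
      by (simp add: sum_distrib_right)
    also have "\<dots> \<le> (C2 * real T powr (1 / real s)) * (C1 * real (m - T) powr (- 1 / real s))"
    proof (rule mult_right_mono)
      have "(\<Sum>i<T. G $ i) \<le> (\<Sum>i\<le>T. G $ i)" using G by (intro sum_mono2) auto
      also have "\<dots> \<le> C2 * real T powr (1 / real s)"
        using that C2(2)[of T] by (simp add: G_def neg_binomial_series_partial_sum)
      finally show "(\<Sum>i<T. G $ i) \<le> C2 * real T powr (1 / real s)" .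
    qed (use C1 in auto)
    also have "\<dots> = C1 * C2 * (real T / real (m - T)) powr (1 / real s)"
      using that by (simp add: powr_divide powr_minus field_simps)
    finally show ?thesis .
  qed
  have "1 - (real s * (C1 * C2)) * (real T / real (m - T)) powr (1 / real s) \<le> (v T ^ s) $ m"
    if "1 \<le> T" "T < m" for T m
  proof -
    have "((u T + v T) ^ Suc (s - 1)) $ m \<le>
        (v T ^ Suc (s - 1)) $ m + real (Suc (s - 1)) * (u T * (u T + v T) ^ (s - 1)) $ m"
      by (rule fps_power_add_le_nth) (use u v in auto)
    moreover have "Suc (s - 1) = s" using assms by simp
    ultimately have "1 \<le> (v T ^ s) $ m + real s * (u T * H) $ m"
      by (simp only: uv Gs H_def)
    moreover have "real s * (u T * H) $ m \<le> real s * (C1 * C2 * (real T / real (m - T)) powr (1 / real s))"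
      using bd[OF that] by (intro mult_left_mono) auto
    ultimately show ?thesis by (simp add: mult_ac)
  qed
  moreover have "real s * (C1 * C2) > 0" using C1 C2 assms by simp
  ultimately show "\<exists>C>0. \<forall>T m. 1 \<le> T \<longrightarrow> T < m \<longrightarrow>
           1 - C * (real T / real (m - T)) powr (1 / real s) \<le> (v T ^ s) $ m" by blast
qed

subsection \<open>Sets with prescribed size and sum\<close>

text \<open>Sets and not tuples, because the probability that all of \<open>X\<close> lies in the
  random set is a product over distinct elements.\<close>

definition sum_sets :: "nat \<Rightarrow> nat \<Rightarrow> nat \<Rightarrow> nat set set" where
  "sum_sets T k m = {X. finite X \<and> card X = k \<and> (\<forall>x\<in>X. T \<le> x) \<and> \<Sum>X = m}"

lemma sum_sets_subset: "sum_sets T k m \<subseteq> Pow {T..m}"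
proof
  fix X assume X: "X \<in> sum_sets T k m"
  then have "x \<le> m" if "x \<in> X" for x
    using member_le_sum[of x X "\<lambda>x. x"] that by (auto simp: sum_sets_def)
  then show "X \<in> Pow {T..m}" using X by (auto simp: sum_sets_def)
qed

lemma finite_sum_sets [simp]: "finite (sum_sets T k m)"
  by (rule finite_subset[OF sum_sets_subset]) auto

text \<open>The sum is prescribed, so the elements other than the maximum determine the
  maximum.\<close>

lemma card_sum_sets_le:
  assumes "k \<ge> 1"
  shows "card (sum_sets T k m) \<le> (m + 1) ^ (k - 1)"
proof -
  let ?r = "\<lambda>X. X - {Max X}"
  have ne: "finite X" "X \<noteq> {}" "Max X \<in> X" "\<Sum>X = m" "card X = k" if "X \<in> sum_sets T k m" for X
  proof -
    show "finite X" "\<Sum>X = m" "card X = k" using that by (auto simp: sum_sets_def)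
    then show "X \<noteq> {}" using assms by auto
    then show "Max X \<in> X" using \<open>finite X\<close> by simp
  qed
  have "inj_on ?r (sum_sets T k m)"
  proof (rule inj_onI)
    fix X Y assume XY: "X \<in> sum_sets T k m" "Y \<in> sum_sets T k m" "?r X = ?r Y"
    have "Max X + \<Sum>(?r X) = m" "Max Y + \<Sum>(?r Y) = m"
      using ne[OF XY(1)] ne[OF XY(2)] sum.remove[of X "Max X" "\<lambda>x. x"] sum.remove[of Y "Max Y" "\<lambda>x. x"]
      by auto
    then have "Max X = Max Y" using XY(3) by simp
    then have "insert (Max X) (?r X) = insert (Max Y) (?r Y)" using XY(3) by simp
    then show "X = Y" using ne(3)[OF XY(1)] ne(3)[OF XY(2)] by (simp add: insert_absorb)
  qed
  moreover have "?r ` sum_sets T k m \<subseteq> {Y. Y \<subseteq> {..m} \<and> card Y = k - 1}"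
  proof (rule image_subsetI)
    fix X assume X: "X \<in> sum_sets T k m"
    moreover have "X \<subseteq> {T..m}" using sum_sets_subset X by blast
    ultimately show "?r X \<in> {Y. Y \<subseteq> {..m} \<and> card Y = k - 1}" using ne[OF X] by auto
  qed
  ultimately have "card (sum_sets T k m) \<le> card {Y. Y \<subseteq> {..m} \<and> card Y = k - 1}"
    by (intro card_inj_on_le[of ?r]) (auto simp: finite_Pow_iff intro: finite_subset[of _ "Pow {..m}"])
  also have "\<dots> = (m + 1) choose (k - 1)"
    by (subst n_subsets) auto
  also have "\<dots> \<le> (m + 1) ^ (k - 1)"
    by (cases "k - 1 \<le> m + 1") (auto simp: binomial_le_pow binomial_eq_0)
  finally show ?thesis .
qed

text \<open>Some two positions i < j carry the same value. The other k - 2 entries determine that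
  value through the total, and there are at most \<open>k\<^sup>2\<close> choices of
  positions.\<close>

lemma card_natpermute_not_distinct_le:
  "card {xs \<in> natpermute m k. \<not> distinct xs} \<le> k\<^sup>2 * (m + 1) ^ (k - 2)"
proof -
  define B where "B = (\<lambda>i j. {xs \<in> natpermute m k. xs ! i = xs ! j})"
  have "card (B i j) \<le> (m + 1) ^ (k - 2)" if ij: "i < j" "j < k" for i j
  proof -
    let ?I = "{..<k} - {i, j}"
    let ?r = "\<lambda>xs. restrict (\<lambda>l. xs ! l) ?I"
    have I: "{..<k} = insert i (insert j ?I)" using ij by auto
    have le: "xs ! l \<le> m" if "xs \<in> natpermute m k" "l < k" for xs l
      using that by (auto simp: natpermute_def intro: member_le_sum_list)
    have tot: "xs ! i + xs ! j + (\<Sum>l\<in>?I. xs ! l) = m" if "xs \<in> natpermute m k" for xs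
    proof -
      have "m = (\<Sum>l<k. xs ! l)" using that by (auto simp: natpermute_def sum_list_sum_nth atLeast0LessThan)
      also have "\<dots> = xs ! i + (xs ! j + (\<Sum>l\<in>?I. xs ! l))"
        using ij by (subst I) simp
      finally show ?thesis by simp
    qed
    have "inj_on ?r (B i j)"
    proof (rule inj_onI)
      fix xs ys assume xy: "xs \<in> B i j" "ys \<in> B i j" "?r xs = ?r ys"
      have eq: "xs ! l = ys ! l" if "l \<in> ?I" for l using fun_cong[OF xy(3), of l] that by simp
      then have "(\<Sum>l\<in>?I. xs ! l) = (\<Sum>l\<in>?I. ys ! l)" by (rule sum.cong[OF refl])
      then have "xs ! i = ys ! i" "xs ! j = ys ! j"
        using xy(1,2) tot[of xs] tot[of ys] by (auto simp: B_def)
      then have "xs ! l = ys ! l" if "l < k" for l using eq[of l] that by (cases "l \<in> {i, j}") auto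
      then show "xs = ys" using xy(1,2) by (intro nth_equalityI) (auto simp: B_def natpermute_def)
    qed
    moreover have "?r ` B i j \<subseteq> ?I \<rightarrow>\<^sub>E {..m}"
      using le by (intro image_subsetI) (auto simp: B_def restrict_PiE_iff simp del: restrict_apply)
    ultimately have "card (B i j) \<le> card (?I \<rightarrow>\<^sub>E {..m})"
      by (intro card_inj_on_le) (auto intro!: finite_PiE)
    also have "\<dots> = (m + 1) ^ (k - 2)"
      using ij by (simp add: card_PiE card_Diff_subset numeral_2_eq_2)
    finally show ?thesis .
  qed
  note B = this
  have "{xs \<in> natpermute m k. \<not> distinct xs} \<subseteq> (\<Union>(i,j)\<in>{(i,j). i < j \<and> j < k}. B i j)"
  proof safe
    fix xs assume xs: "xs \<in> natpermute m k" "\<not> distinct xs"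
    then obtain i j where "i < length xs" "j < length xs" "i \<noteq> j" "xs ! i = xs ! j"
      by (auto simp: distinct_conv_nth)
    then have "(i, j) \<in> {(i,j). i < j \<and> j < k} \<and> xs \<in> B i j \<or> (j, i) \<in> {(i,j). i < j \<and> j < k} \<and> xs \<in> B j i"
      using xs(1) by (auto simp: natpermute_def B_def)
    then show "xs \<in> (\<Union>(i,j)\<in>{(i,j). i < j \<and> j < k}. B i j)" by blast
  qed
  moreover have fin: "finite {(i,j). i < j \<and> j < k}"
    by (rule finite_subset[of _ "{..<k} \<times> {..<k}"]) auto
  ultimately have "card {xs \<in> natpermute m k. \<not> distinct xs} \<le> card (\<Union>(i,j)\<in>{(i,j). i < j \<and> j < k}. B i j)"
    by (intro card_mono finite_UN_I fin) (auto simp: B_def natpermute_finite)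
  also have "\<dots> \<le> (\<Sum>x\<in>{(i,j). i < j \<and> j < k}. card (case x of (i, j) \<Rightarrow> B i j))"
    by (rule card_UN_le[OF fin])
  also have "\<dots> \<le> (\<Sum>x\<in>{(i,j). i < j \<and> j < k}. (m + 1) ^ (k - 2))"
    using B by (intro sum_mono) auto
  also have "\<dots> = card {(i,j). i < j \<and> j < k} * (m + 1) ^ (k - 2)" by simp
  also have "card {(i,j). i < j \<and> j < k} \<le> card ({..<k} \<times> {..<k})"
    by (intro card_mono) auto
  finally show ?thesis by (simp add: power2_eq_square)
qed

text \<open>The coefficient is a sum over lists of length k with total m. Lists with distinct
  entries, all at least \<open>T\<close>, are grouped by their set of entries, each set arising from
  k! lists; the lists with repetitions stay as an explicit error term.\<close>

lemma sum_sum_sets_fps_power: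
  fixes p :: "nat \<Rightarrow> real"
  assumes "k \<ge> 1"
  shows "(Abs_fps (\<lambda>n. if n < T then 0 else p n) ^ k) $ m =
     fact k * (\<Sum>X\<in>sum_sets T k m. \<Prod>x\<in>X. p x) +
     (\<Sum>xs | xs \<in> natpermute m k \<and> \<not> distinct xs. \<Prod>j<k. if xs ! j < T then 0 else p (xs ! j))"
proof -
  define w where "w = (\<lambda>xs. \<Prod>j<k. if xs ! j < T then 0 else p (xs ! j))"
  define L where "L = {xs \<in> natpermute m k. distinct xs \<and> (\<forall>x\<in>set xs. T \<le> x)}"
  have idx: "{0..k - Suc 0} = {..<k}" using assms by auto
  have "(Abs_fps (\<lambda>n. if n < T then 0 else p n) ^ k) $ m = (\<Sum>xs\<in>natpermute m k. w xs)"
    using assms by (simp add: fps_power_nth w_def idx)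
  also have "natpermute m k = {xs \<in> natpermute m k. distinct xs} \<union> {xs \<in> natpermute m k. \<not> distinct xs}"
    by blast
  also have "(\<Sum>xs\<in>\<dots>. w xs) = (\<Sum>xs | xs \<in> natpermute m k \<and> distinct xs. w xs)
      + (\<Sum>xs | xs \<in> natpermute m k \<and> \<not> distinct xs. w xs)"
    by (intro sum.union_disjoint) (auto simp: natpermute_finite)
  also have "(\<Sum>xs | xs \<in> natpermute m k \<and> distinct xs. w xs) = (\<Sum>xs\<in>L. w xs)"
  proof (rule sum.mono_neutral_right)
    show "\<forall>xs\<in>{xs \<in> natpermute m k. distinct xs} - L. w xs = 0"
    proof
      fix xs assume xs: "xs \<in> {xs \<in> natpermute m k. distinct xs} - L"
      then obtain j where "j < k" "xs ! j < T"
        by (auto simp: L_def in_set_conv_nth natpermute_def not_le)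
      then show "w xs = 0" by (auto simp: w_def intro!: prod_zero)
    qed
  qed (auto simp: L_def natpermute_finite)
  also have "\<dots> = (\<Sum>X\<in>sum_sets T k m. \<Sum>xs | xs \<in> L \<and> set xs = X. w xs)"
  proof (rule sum.group[symmetric])
    show "set ` L \<subseteq> sum_sets T k m"
      by (auto simp: L_def natpermute_def sum_sets_def distinct_card sum_list_distinct_conv_sum_set[of _ "\<lambda>x. x", simplified])
  qed (auto simp: L_def natpermute_finite)
  also have "\<dots> = (\<Sum>X\<in>sum_sets T k m. fact k * (\<Prod>x\<in>X. p x))"
  proof (rule sum.cong[OF refl])
    fix X assume X: "X \<in> sum_sets T k m"
    have "{xs. xs \<in> L \<and> set xs = X} = permutations_of_set X"
      using X by (auto simp: L_def natpermute_def sum_sets_def permutations_of_set_def distinct_card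
          sum_list_distinct_conv_sum_set[of _ "\<lambda>x. x", simplified])
    moreover have "w xs = (\<Prod>x\<in>X. p x)" if "xs \<in> permutations_of_set X" for xs
    proof -
      have xs: "distinct xs" "set xs = X" "length xs = k" "\<And>j. j < k \<Longrightarrow> T \<le> xs ! j"
        using that X by (auto simp: permutations_of_set_def sum_sets_def distinct_card)
      have "w xs = (\<Prod>j<k. p (xs ! j))" unfolding w_def
        using xs(4) by (intro prod.cong refl) (simp add: leD)
      also have "\<dots> = (\<Prod>x\<in>X. p x)"
        using xs by (intro prod.reindex_bij_betw bij_betw_nth) auto
      finally show ?thesis .
    qed
    ultimately show "(\<Sum>xs | xs \<in> L \<and> set xs = X. w xs) = fact k * (\<Prod>x\<in>X. p x)"
      using X by (simp add: sum_sets_def)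
  qed
  finally show ?thesis by (simp add: w_def sum_distrib_left)
qed

text \<open>The lists with repetitions contribute between 0 and their number times
  \<open>B ^ k\<close>. In the application k = s, m is at most n and \<open>B\<close> has order
  n^(1/s-1), which makes this error O(1/n).\<close>

lemma sum_sum_sets_bounds:
  fixes p :: "nat \<Rightarrow> real" and m :: nat
  assumes "k \<ge> 1" "\<And>n. p n \<ge> 0" "\<And>n. T \<le> n \<Longrightarrow> p n \<le> B" "B \<ge> 0"
  defines "c \<equiv> (Abs_fps (\<lambda>n. if n < T then 0 else p n) ^ k) $ m"
  shows "fact k * (\<Sum>X\<in>sum_sets T k m. \<Prod>x\<in>X. p x) \<le> c"
    and "c \<le> fact k * (\<Sum>X\<in>sum_sets T k m. \<Prod>x\<in>X. p x) + real (k\<^sup>2 * (m + 1) ^ (k - 2)) * B ^ k"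
proof -
  let ?w = "\<lambda>xs. \<Prod>j<k. if xs ! j < T then 0 else p (xs ! j)"
  let ?A = "{xs \<in> natpermute m k. \<not> distinct xs}"
  have "0 \<le> sum ?w ?A" using assms by (intro sum_nonneg prod_nonneg) auto
  then show "fact k * (\<Sum>X\<in>sum_sets T k m. \<Prod>x\<in>X. p x) \<le> c"
    unfolding c_def sum_sum_sets_fps_power[OF assms(1)] by simp
  have "sum ?w ?A \<le> (\<Sum>xs\<in>?A. B ^ k)"
  proof (rule sum_mono)
    fix xs
    have "?w xs \<le> (\<Prod>j<k. B)" using assms by (intro prod_mono) auto
    then show "?w xs \<le> B ^ k" by simp
  qed
  also have "\<dots> = real (card ?A) * B ^ k" by simp
  also have "\<dots> \<le> real (k\<^sup>2 * (m + 1) ^ (k - 2)) * B ^ k"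
    using card_natpermute_not_distinct_le[of m k] assms(4)
    by (intro mult_right_mono zero_le_power) (simp_all only: of_nat_le_iff)
  finally show "c \<le> fact k * (\<Sum>X\<in>sum_sets T k m. \<Prod>x\<in>X. p x) + real (k\<^sup>2 * (m + 1) ^ (k - 2)) * B ^ k"
    unfolding c_def sum_sum_sets_fps_power[OF assms(1)] by simp
qed

section \<open>Total weight of overlapping pairs of sets\<close>

lemma prod_antimono_subset:
  fixes p :: "'a \<Rightarrow> real"
  assumes "\<And>x. 0 \<le> p x" "\<And>x. p x \<le> 1" "finite A" "B \<subseteq> A"
  shows "prod p A \<le> prod p B"
proof -
  have "prod p A = prod p (A - B) * prod p B" using assms by (intro prod.subset_diff) auto
  also have "\<dots> \<le> 1 * prod p B" using assms by (intro mult_right_mono prod_le_1 prod_nonneg) auto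
  finally show ?thesis by simp
qed

text \<open>\<open>Y\<close> is encoded by its trace \<open>W\<close> on \<open>X\<close> and the
  remainder \<open>Y - X\<close>. The trace is nonempty and, since \<open>X\<close> and
  \<open>Y\<close> are different sets of equal size, a proper subset of \<open>X\<close>. This
  leaves at most 2^s traces, and for each the remainders have total weight at most
  \<open>\<beta>\<close>.\<close>

lemma sum_overlapping_sum_sets_le:
  fixes p :: "nat \<Rightarrow> real"
  assumes p: "\<And>x. 0 \<le> p x" and X: "X \<in> sum_sets T s m" and "\<beta> \<ge> 0"
    and \<beta>: "\<And>k j. 1 \<le> k \<Longrightarrow> k < s \<Longrightarrow> j \<le> m' \<Longrightarrow> (\<Sum>Z\<in>sum_sets T k j. prod p Z) \<le> \<beta>"
  shows "(\<Sum>Y | Y \<in> sum_sets T s m' \<and> Y \<noteq> X \<and> X \<inter> Y \<noteq> {}. prod p (X \<union> Y)) \<le> 2 ^ s * \<beta> * prod p X"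
proof -
  let ?I = "{Y. Y \<in> sum_sets T s m' \<and> Y \<noteq> X \<and> X \<inter> Y \<noteq> {}}"
  let ?W = "{W. W \<subseteq> X \<and> W \<noteq> {} \<and> W \<noteq> X}"
  \<comment> \<open>The subtraction truncates when \<open>\<Sum>W\<close> exceeds \<open>m'\<close>.
    This only adds nonnegative terms to an upper bound; for actual traces the difference is
    exact.\<close>
  let ?J = "Sigma ?W (\<lambda>W. sum_sets T (s - card W) (m' - \<Sum>W))"
  let ?\<phi> = "\<lambda>Y. (X \<inter> Y, Y - X)"
  have finX: "finite X" "card X = s" using X by (auto simp: sum_sets_def)
  have finW: "finite ?W" using finX by (auto intro: finite_subset[of _ "Pow X"])
  have "(\<Sum>Y\<in>?I. prod p (X \<union> Y)) = (\<Sum>Y\<in>?I. prod p X * prod p (snd (?\<phi> Y)))"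
  proof (rule sum.cong[OF refl])
    fix Y assume "Y \<in> ?I"
    then have "prod p (X \<union> (Y - X)) = prod p X * prod p (Y - X)"
      using finX by (intro prod.union_disjoint) (auto simp: sum_sets_def)
    then show "prod p (X \<union> Y) = prod p X * prod p (snd (?\<phi> Y))" by simp
  qed
  also have "\<dots> = prod p X * (\<Sum>z\<in>?\<phi> ` ?I. prod p (snd z))"
  proof -
    have "inj_on ?\<phi> ?I" by (rule inj_onI) blast
    then show ?thesis by (simp add: sum.reindex sum_distrib_left)
  qed
  also have "\<dots> \<le> prod p X * (\<Sum>z\<in>?J. prod p (snd z))"
  proof (intro mult_left_mono sum_mono2 prod_nonneg p)
    show "finite ?J" using finW by auto
    show "?\<phi> ` ?I \<subseteq> ?J"
    proof (rule image_subsetI)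
      fix Y assume Y: "Y \<in> ?I"
      then have Y': "finite Y" "card Y = s" "\<Sum>Y = m'" "\<forall>y\<in>Y. T \<le> y" by (auto simp: sum_sets_def)
      have "X \<inter> Y \<noteq> X"
      proof
        assume "X \<inter> Y = X"
        then have "X = Y" using Y' finX by (intro card_subset_eq) auto
        then show False using Y by blast
      qed
      moreover have "card (Y - X) = s - card (X \<inter> Y)"
        using Y' by (simp add: card_Diff_subset_Int Int_commute)
      moreover have "\<Sum>(Y - X) = m' - \<Sum>(X \<inter> Y)"
        using sum.Int_Diff[OF Y'(1), of "\<lambda>x. x" X] Y'(3) by (simp add: Int_commute)
      ultimately show "?\<phi> Y \<in> ?J" using Y Y' by (auto simp: sum_sets_def)
    qed
  qed
  also have "\<dots> \<le> prod p X * (2 ^ s * \<beta>)"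
  proof (rule mult_left_mono)
    have "(\<Sum>z\<in>?J. prod p (snd z)) = (\<Sum>W\<in>?W. \<Sum>Z\<in>sum_sets T (s - card W) (m' - \<Sum>W). prod p Z)"
      using finW by (subst sum.Sigma) (auto simp: case_prod_unfold)
    also have "\<dots> \<le> (\<Sum>W\<in>?W. \<beta>)"
    proof (intro sum_mono \<beta>)
      fix W assume W: "W \<in> ?W"
      then have "card W < s" "card W \<noteq> 0" using finX psubset_card_mono[of X W] finite_subset[of W X] by auto
      then show "1 \<le> s - card W" "s - card W < s" by auto
    qed auto
    also have "\<dots> = real (card ?W) * \<beta>" by simp
    also have "\<dots> \<le> 2 ^ s * \<beta>"
    proof (rule mult_right_mono)
      have "card ?W \<le> card (Pow X)" using finX by (intro card_mono) auto
      also have "\<dots> = 2 ^ s" using finX by (simp add: card_Pow)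
      finally show "real (card ?W) \<le> 2 ^ s" by (metis of_nat_le_iff of_nat_numeral of_nat_power)
    qed fact
    finally show "(\<Sum>z\<in>?J. prod p (snd z)) \<le> 2 ^ s * \<beta>" .
  qed (use p in \<open>simp add: prod_nonneg\<close>)
  finally show ?thesis by (simp only: mult_ac)
qed

text \<open>These are the quantities of Janson's inequality for the sets \<open>F (b, X)\<close>:
  the expectation, and the sum over dependent pairs. Every \<open>b\<close> lies below
  \<open>T\<close> and every element of \<open>X\<close> is at least \<open>T\<close>, so
  \<open>b\<close> is never in \<open>X\<close>. Dependent pairs thus share \<open>b\<close> while
  their \<open>X\<close> parts are disjoint, which gives \<open>p b * (R b)\<^sup>2\<close>, or
  their \<open>X\<close> parts meet, which is controlled by \<open>\<beta>\<close>.\<close>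

lemma
  fixes p :: "nat \<Rightarrow> real" and n :: nat
  assumes p: "\<And>x. 0 \<le> p x" "\<And>x. p x \<le> 1" and B: "finite B" "\<And>b. b \<in> B \<Longrightarrow> b < T \<and> b \<le> n"
    and "\<beta> \<ge> 0"
    and \<beta>: "\<And>k j. 1 \<le> k \<Longrightarrow> k < s \<Longrightarrow> j \<le> n \<Longrightarrow> (\<Sum>Z\<in>sum_sets T k j. prod p Z) \<le> \<beta>"
  defines "R \<equiv> \<lambda>b. \<Sum>X\<in>sum_sets T s (n - b). prod p X"
    and "K \<equiv> Sigma B (\<lambda>b. sum_sets T s (n - b))"
    and "F \<equiv> \<lambda>(b, X). insert b X"
  shows sum_prod_insert_sum_sets: "(\<Sum>x\<in>K. prod p (F x)) = (\<Sum>b\<in>B. p b * R b)"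
    and sum_prod_overlapping_insert_sum_sets:
      "(\<Sum>x\<in>K. \<Sum>y | y \<in> K \<and> y \<noteq> x \<and> F x \<inter> F y \<noteq> {}. prod p (F x \<union> F y))
        \<le> (\<Sum>b\<in>B. p b * (R b)\<^sup>2) + real (card B) * (2 ^ s * \<beta>) * (\<Sum>b\<in>B. R b)"
proof -
  have S: "finite X" "b \<notin> X" if "b \<in> B" "X \<in> sum_sets T s m" for b X m
    using that B(2)[of b] by (auto simp: sum_sets_def)
  have "(\<Sum>x\<in>K. prod p (F x)) = (\<Sum>b\<in>B. \<Sum>X\<in>sum_sets T s (n - b). prod p (insert b X))"
    unfolding K_def F_def using B by (subst sum.Sigma) (auto simp: case_prod_unfold)
  also have "\<dots> = (\<Sum>b\<in>B. \<Sum>X\<in>sum_sets T s (n - b). p b * prod p X)"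
    using S by (intro sum.cong refl) (simp add: prod.insert)
  finally show "(\<Sum>x\<in>K. prod p (F x)) = (\<Sum>b\<in>B. p b * R b)"
    by (simp add: R_def sum_distrib_left)
  have inner: "(\<Sum>y | y \<in> K \<and> y \<noteq> (b, X) \<and> F (b, X) \<inter> F y \<noteq> {}. prod p (F (b, X) \<union> F y))
      \<le> p b * prod p X * R b + real (card B) * (2 ^ s * \<beta>) * prod p X"
    if b: "b \<in> B" and X: "X \<in> sum_sets T s (n - b)" for b X
  proof -
    let ?S1 = "{b} \<times> {Y \<in> sum_sets T s (n - b). X \<inter> Y = {}}"
    let ?S2 = "Sigma B (\<lambda>b'. {Y. Y \<in> sum_sets T s (n - b') \<and> Y \<noteq> X \<and> X \<inter> Y \<noteq> {}})"
    have sub: "{y. y \<in> K \<and> y \<noteq> (b, X) \<and> F (b, X) \<inter> F y \<noteq> {}} \<subseteq> ?S1 \<union> ?S2"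
    proof
      fix y assume y: "y \<in> {y. y \<in> K \<and> y \<noteq> (b, X) \<and> F (b, X) \<inter> F y \<noteq> {}}"
      obtain b' Y where bY: "y = (b', Y)" by (cases y)
      have b': "b' \<in> B" and Y: "Y \<in> sum_sets T s (n - b')" and ne: "(b', Y) \<noteq> (b, X)"
        and meet: "insert b X \<inter> insert b' Y \<noteq> {}" using y by (auto simp: bY K_def F_def)
      show "y \<in> ?S1 \<union> ?S2"
      proof (cases "X \<inter> Y = {}")
        case True
        then have "b = b'" using meet S[OF b Y] S[OF b' X] by auto
        then show ?thesis using True Y by (auto simp: bY)
      next
        case False
        \<comment> \<open>Equal sets have equal sums, and \<open>b\<close>, \<open>b'\<close> are at
          most \<open>n\<close>, so the pairs would coincide.\<close>
        have "Y \<noteq> X"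
        proof
          assume "Y = X"
          then have "n - b = n - b'" using X Y by (simp add: sum_sets_def)
          then have "b = b'" using B(2)[OF b] B(2)[OF b'] by linarith
          then show False using ne \<open>Y = X\<close> by simp
        qed
        then show ?thesis using False b' Y by (auto simp: bY)
      qed
    qed
    have pr: "0 \<le> prod p A" for A using p by (simp add: prod_nonneg)
    have "(\<Sum>y | y \<in> K \<and> y \<noteq> (b, X) \<and> F (b, X) \<inter> F y \<noteq> {}. prod p (F (b, X) \<union> F y))
        \<le> (\<Sum>y\<in>?S1 \<union> ?S2. prod p (F (b, X) \<union> F y))"
      using B by (intro sum_mono2 sub pr) auto
    also have "\<dots> = (\<Sum>y\<in>?S1. prod p (F (b, X) \<union> F y)) + (\<Sum>y\<in>?S2. prod p (F (b, X) \<union> F y))"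
      using B by (intro sum.union_disjoint) auto
    also have "(\<Sum>y\<in>?S1. prod p (F (b, X) \<union> F y)) \<le> p b * prod p X * R b"
    proof -
      have "(\<Sum>y\<in>?S1. prod p (F (b, X) \<union> F y)) =
          (\<Sum>Y | Y \<in> sum_sets T s (n - b) \<and> X \<inter> Y = {}. prod p (insert b X \<union> insert b Y))"
        by (rule sum.reindex_bij_witness[of _ "\<lambda>Y. (b, Y)" snd]) (auto simp: F_def)
      also have "\<dots> = (\<Sum>Y | Y \<in> sum_sets T s (n - b) \<and> X \<inter> Y = {}. p b * prod p X * prod p Y)"
      proof (rule sum.cong[OF refl])
        fix Y assume Y: "Y \<in> {Y. Y \<in> sum_sets T s (n - b) \<and> X \<inter> Y = {}}"
        have "insert b X \<union> insert b Y = insert b (X \<union> Y)" by auto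
        then show "prod p (insert b X \<union> insert b Y) = p b * prod p X * prod p Y"
          using S[OF b X] S[OF b, of Y "n - b"] Y by (simp add: prod.union_disjoint)
      qed
      also have "\<dots> \<le> (\<Sum>Y\<in>sum_sets T s (n - b). p b * prod p X * prod p Y)"
        using p pr by (intro sum_mono2) auto
      finally show ?thesis by (simp add: R_def sum_distrib_left)
    qed
    also have "(\<Sum>y\<in>?S2. prod p (F (b, X) \<union> F y)) \<le> real (card B) * (2 ^ s * \<beta>) * prod p X"
    proof -
      \<comment> \<open>The factors coming from \<open>b\<close> and \<open>b'\<close> are at most 1
        and are dropped. The loss is affordable because \<open>\<beta>\<close> will be a negative
        power of n while \<open>card B\<close> is only polylogarithmic.\<close>
      have "(\<Sum>y\<in>?S2. prod p (F (b, X) \<union> F y)) \<le> (\<Sum>y\<in>?S2. prod p (X \<union> snd y))"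
        using S[OF _ X] S by (intro sum_mono prod_antimono_subset p) (auto simp: F_def)
      also have "\<dots> = (\<Sum>b'\<in>B. \<Sum>Y | Y \<in> sum_sets T s (n - b') \<and> Y \<noteq> X \<and> X \<inter> Y \<noteq> {}. prod p (X \<union> Y))"
        using B by (subst sum.Sigma) (auto simp: case_prod_unfold)
      also have "\<dots> \<le> (\<Sum>b'\<in>B. 2 ^ s * \<beta> * prod p X)"
        using \<open>\<beta> \<ge> 0\<close> by (intro sum_mono sum_overlapping_sum_sets_le[OF p(1) X] \<beta>) auto
      finally show ?thesis by simp
    qed
    finally show ?thesis by simp
  qed
  have "(\<Sum>x\<in>K. \<Sum>y | y \<in> K \<and> y \<noteq> x \<and> F x \<inter> F y \<noteq> {}. prod p (F x \<union> F y)) =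
     (\<Sum>b\<in>B. \<Sum>X\<in>sum_sets T s (n - b).
        \<Sum>y | y \<in> K \<and> y \<noteq> (b, X) \<and> F (b, X) \<inter> F y \<noteq> {}. prod p (F (b, X) \<union> F y))"
    using B by (subst sum.Sigma) (auto simp: K_def case_prod_unfold)
  also have "\<dots> \<le> (\<Sum>b\<in>B. \<Sum>X\<in>sum_sets T s (n - b).
      p b * prod p X * R b + real (card B) * (2 ^ s * \<beta>) * prod p X)"
    by (intro sum_mono inner)
  also have "\<dots> = (\<Sum>b\<in>B. p b * (R b)\<^sup>2 + real (card B) * (2 ^ s * \<beta>) * R b)"
  proof (rule sum.cong[OF refl])
    fix b
    have "(\<Sum>X\<in>sum_sets T s (n - b). p b * prod p X * R b) = p b * (\<Sum>X\<in>sum_sets T s (n - b). prod p X) * R b"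
      by (simp add: sum_distrib_left sum_distrib_right)
    then show "(\<Sum>X\<in>sum_sets T s (n - b). p b * prod p X * R b + real (card B) * (2 ^ s * \<beta>) * prod p X)
        = p b * (R b)\<^sup>2 + real (card B) * (2 ^ s * \<beta>) * R b"
      by (simp add: sum.distrib R_def power2_eq_square sum_distrib_left[symmetric])
  qed
  finally show "(\<Sum>x\<in>K. \<Sum>y | y \<in> K \<and> y \<noteq> x \<and> F x \<inter> F y \<noteq> {}. prod p (F x \<union> F y))
        \<le> (\<Sum>b\<in>B. p b * (R b)\<^sup>2) + real (card B) * (2 ^ s * \<beta>) * (\<Sum>b\<in>B. R b)"
    by (simp add: sum.distrib sum_distrib_left)
qed

subsection \<open>Expected number of representations\<close>

lemma power_mult_powr_power:
  fixes x :: real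
  assumes "x > 0"
  shows "(a * x) ^ j * (b * x powr e) ^ k = a ^ j * b ^ k * x powr (real j + e * real k)"
proof -
  have "(a * x) ^ j * (b * x powr e) ^ k = a ^ j * b ^ k * (x ^ j * (x powr e) ^ k)"
    by (simp add: power_mult_distrib)
  also have "x ^ j * (x powr e) ^ k = x powr (real j + e * real k)"
    using assms by (simp add: powr_add powr_realpow powr_power mult.commute)
  finally show ?thesis .
qed

text \<open>The value at 0 is 0, since \<open>0 powr x = 0\<close>. This agrees with 0 never
  belonging to the random set.\<close>

definition pseudo_power_prob :: "nat \<Rightarrow> nat \<Rightarrow> real" where
  "pseudo_power_prob s n = 1 / real s * real n powr (-1 + 1 / real s)"

lemma pseudo_power_prob_nonneg: "pseudo_power_prob s n \<ge> 0"
  by (simp add: pseudo_power_prob_def)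

lemma pseudo_power_prob_le_powr:
  assumes "s \<ge> 2" "0 < x" "x \<le> real n"
  shows "pseudo_power_prob s n \<le> x powr (-1 + 1 / real s)"
proof -
  have "1 / real s * real n powr (-1 + 1 / real s) \<le> 1 * real n powr (-1 + 1 / real s)"
    using assms by (intro mult_right_mono) auto
  also have "\<dots> \<le> x powr (-1 + 1 / real s)"
    using assms powr_mono2'[of "-1 + 1 / real s" x "real n"] by simp
  finally show ?thesis by (simp add: pseudo_power_prob_def)
qed

lemma pseudo_power_prob_le_1: "s \<ge> 2 \<Longrightarrow> pseudo_power_prob s n \<le> 1"
  using pseudo_power_prob_le_powr[of s 1 n] by (cases "n = 0") (auto simp: pseudo_power_prob_def)

lemma pseudo_power_prob_asymptotic:
  assumes "s \<ge> 2"
  shows "(\<lambda>n. pseudo_power_prob s n / neg_binomial_series (1 / real s) $ n)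
    \<longlonglongrightarrow> Gamma (1 / real s) / real s"
proof -
  have "Gamma (1 / real s) \<noteq> 0" using assms by (intro less_imp_neq[symmetric] Gamma_real_pos) simp
  then have "(\<lambda>n. 1 / real s * inverse (neg_binomial_series (1 / real s) $ n / real n powr (1 / real s - 1)))
      \<longlonglongrightarrow> 1 / real s * inverse (inverse (Gamma (1 / real s)))"
    by (intro tendsto_mult tendsto_const tendsto_inverse neg_binomial_series_asymptotic) auto
  then show ?thesis by (simp add: pseudo_power_prob_def field_simps)
qed

lemma pseudo_power_lambda_eq: "pseudo_power_lambda s = (Gamma (1 / real s) / real s) ^ s / fact s"
  by (simp add: pseudo_power_lambda_def power_divide)

lemma pseudo_power_lambda_pos: "s \<ge> 2 \<Longrightarrow> pseudo_power_lambda s > 0"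
  by (simp add: pseudo_power_lambda_def)

text \<open>Log-convexity of Gamma between 1 and 2 gives Gamma(1 + 1/s) at most 1, hence a bound of
  1/s!, which suffices from s = 3 on. For s = 2 it would only give 1/2 without strictness, so the
  exact value pi/8 is used.\<close>

lemma pseudo_power_lambda_less:
  assumes "s \<ge> 2"
  shows "pseudo_power_lambda s < 1 / 2"
proof (cases "s = 2")
  case True
  then have "pseudo_power_lambda s = pi / 8"
    by (simp add: pseudo_power_lambda_def Gamma_one_half_real power2_eq_square)
  then show ?thesis using pi_less_4 by simp
next
  case False
  with assms have s: "s \<ge> 3" by simp
  define x where "x = 1 / real s"
  have x: "0 < x" "x \<le> 1" using s by (auto simp: x_def)
  have "(ln \<circ> Gamma) ((1 - x) *\<^sub>R 1 + x *\<^sub>R 2) \<le> (1 - x) * (ln \<circ> Gamma) (1::real) + x * (ln \<circ> Gamma) 2"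
    using x by (intro convex_onD[OF log_convex_Gamma_real]) auto
  moreover have "Gamma (2::real) = 1" using Gamma_fact[of 1, where 'a = real] by simp
  ultimately have "ln (Gamma (1 + x)) \<le> 0" by (simp add: algebra_simps)
  moreover have "Gamma (1 + x) > 0" using x by simp
  ultimately have "Gamma (x + 1) \<le> 1" by (simp add: add.commute)
  moreover have "Gamma (x + 1) = x * Gamma x" using x by (intro Gamma_plus1) (auto dest: nonpos_Ints_nonpos)
  ultimately have "x * Gamma x \<le> 1" by simp
  then have "(x * Gamma x) ^ s \<le> 1" using x by (intro power_le_one) auto
  then have "pseudo_power_lambda s \<le> 1 / fact s"
    by (simp add: pseudo_power_lambda_eq x_def divide_right_mono)
  also have "\<dots> \<le> 1 / fact 3" using s by (intro divide_left_mono fact_mono) auto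
  also have "\<dots> < 1 / 2" by (simp add: fact_numeral)
  finally show ?thesis .
qed

text \<open>There are O(n^(k-1)) sets, each of weight O(n^(k/s-k)), for a total of O(n^(k/s-1)). As
  k + 1 is at most s, this is O(n^(-1/s)). It supplies the \<open>\<beta>\<close> of the overlap
  estimates.\<close>

lemma sum_sum_sets_pseudo_power_prob_le:
  assumes "s \<ge> 2" "0 < \<delta>" "\<delta> \<le> 1" "n \<ge> 1" "\<delta> * real n \<le> real T" "m \<le> n" "1 \<le> k" "k < s"
  shows "(\<Sum>X\<in>sum_sets T k m. \<Prod>x\<in>X. pseudo_power_prob s x)
     \<le> (2 * \<delta> powr (-1 + 1 / real s)) ^ s * real n powr (- 1 / real s)"
proof -
  define e where "e = -1 + 1 / real s"
  define D where "D = \<delta> powr e"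
  have "D \<ge> 1" using assms powr_mono2'[of e \<delta> 1] by (simp add: D_def e_def)
  have "(\<Prod>x\<in>X. pseudo_power_prob s x) \<le> (D * real n powr e) ^ k" if "X \<in> sum_sets T k m" for X
  proof -
    have "(\<Prod>x\<in>X. pseudo_power_prob s x) \<le> (\<Prod>x\<in>X. D * real n powr e)"
    proof (intro prod_mono conjI pseudo_power_prob_nonneg)
      fix x assume "x \<in> X"
      then have "pseudo_power_prob s x \<le> (\<delta> * real n) powr e"
        using that assms unfolding e_def by (intro pseudo_power_prob_le_powr) (auto simp: sum_sets_def)
      then show "pseudo_power_prob s x \<le> D * real n powr e" using assms by (simp add: D_def powr_mult)
    qed
    also have "\<dots> = (D * real n powr e) ^ k" using that by (simp add: sum_sets_def)
    finally show ?thesis .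
  qed
  then have "(\<Sum>X\<in>sum_sets T k m. \<Prod>x\<in>X. pseudo_power_prob s x)
      \<le> (\<Sum>X\<in>sum_sets T k m. (D * real n powr e) ^ k)" by (rule sum_mono)
  also have "\<dots> = real (card (sum_sets T k m)) * (D * real n powr e) ^ k" by simp
  also have "\<dots> \<le> (2 * real n) ^ (k - 1) * (D * real n powr e) ^ k"
  proof (rule mult_right_mono)
    have "real (card (sum_sets T k m)) \<le> real ((m + 1) ^ (k - 1))"
      using card_sum_sets_le[OF \<open>1 \<le> k\<close>] by (simp only: of_nat_le_iff)
    also have "\<dots> \<le> (2 * real n) ^ (k - 1)"
      using assms unfolding of_nat_power by (intro power_mono) auto
    finally show "real (card (sum_sets T k m)) \<le> (2 * real n) ^ (k - 1)" .
  qed (use \<open>D \<ge> 1\<close> in auto)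
  also have "\<dots> = 2 ^ (k - 1) * D ^ k * real n powr (real (k - 1) + e * real k)"
    using assms by (intro power_mult_powr_power) auto
  also have "\<dots> \<le> 2 ^ s * D ^ s * real n powr (- 1 / real s)"
  proof (intro mult_mono)
    show "(2::real) ^ (k - 1) \<le> 2 ^ s" "D ^ k \<le> D ^ s"
      using assms \<open>D \<ge> 1\<close> by (auto intro!: power_increasing)
    have "(real k + 1) / real s \<le> 1" using assms by simp
    then have "real (k - 1) + e * real k \<le> - 1 / real s"
      using assms by (simp add: e_def algebra_simps of_nat_diff add_divide_distrib)
    then show "real n powr (real (k - 1) + e * real k) \<le> real n powr (- 1 / real s)"
      using assms by (intro powr_mono) auto
  qed (use \<open>D \<ge> 1\<close> in auto)
  finally show ?thesis by (simp add: D_def e_def power_mult_distrib)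
qed

text \<open>From \<open>T\<close> on, \<open>p\<close> lies between \<open>(L - \<eta>) * G\<close>
  and \<open>(L + \<eta>) * G\<close>, so the s-th power of its truncated series is squeezed between
  multiples of the powers of the truncated \<open>G\<close>, whose coefficients are close to 1. The
  estimate is uniform over m between n/2 and n, as m will be n - b.\<close>

lemma sum_sum_sets_pseudo_power_prob_asymptotic:
  assumes "s \<ge> 2" "\<epsilon> > 0"
  shows "\<exists>\<delta>>0. \<delta> \<le> 1/8 \<and> (\<forall>\<^sub>F n in sequentially. \<forall>m. n \<le> 2 * m \<longrightarrow> m \<le> n \<longrightarrow>
     \<bar>(\<Sum>X\<in>sum_sets (nat \<lceil>\<delta> * real n\<rceil>) s m. \<Prod>x\<in>X. pseudo_power_prob s x) - pseudo_power_lambda s\<bar> \<le> \<epsilon>)"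
proof -
  define p where "p = pseudo_power_prob s"
  define G where "G = neg_binomial_series (1 / real s)"
  define L where "L = Gamma (1 / real s) / real s"
  define e where "e = -1 + 1 / real s"
  define v where "v = (\<lambda>T. G - fps_cutoff T G)"
  have L: "L > 0" using assms by (simp add: L_def)
  have G: "G $ n > 0" for n using assms by (simp add: G_def neg_binomial_series_pos)
  have v0: "v T $ n = (if n < T then 0 else G $ n)" for T n by (simp add: v_def)
  obtain C where C: "C > 0" "\<And>T m. 1 \<le> T \<Longrightarrow> T < m \<Longrightarrow>
      1 - C * (real T / real (m - T)) powr (1 / real s) \<le> (v T ^ s) $ m"
    using neg_binomial_series_tail_power(1)[OF assms(1)] unfolding v_def G_def by blast
  have v1: "(v T ^ s) $ m \<le> 1" for T m
    using neg_binomial_series_tail_power(2)[OF assms(1)] unfolding v_def G_def by blast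
  \<comment> \<open>A single \<open>\<eta>\<close> bounds both the deviation of
    \<open>p n / G $ n\<close> from \<open>L\<close> and the truncation loss.\<close>
  have "\<forall>\<^sub>F \<eta> in at_right 0. (L + \<eta>) ^ s < L ^ s + \<epsilon> / 2"
    by (rule order_tendstoD) (use assms in \<open>auto intro!: tendsto_eq_intros\<close>)
  moreover have "\<forall>\<^sub>F \<eta> in at_right 0. L ^ s - \<epsilon> / 2 < (L - \<eta>) ^ s * (1 - \<eta>)"
    by (rule order_tendstoD) (use assms in \<open>auto intro!: tendsto_eq_intros\<close>)
  moreover have "\<forall>\<^sub>F \<eta> in at_right 0. \<eta> \<in> {0<..<min L 1}"
    using L by (intro eventually_at_right_real) auto
  ultimately have "\<forall>\<^sub>F \<eta> in at_right 0. (L + \<eta>) ^ s < L ^ s + \<epsilon> / 2 \<and>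
      L ^ s - \<epsilon> / 2 < (L - \<eta>) ^ s * (1 - \<eta>) \<and> \<eta> \<in> {0<..<min L 1}"
    by eventually_elim auto
  then obtain \<eta> where \<eta>: "(L + \<eta>) ^ s < L ^ s + \<epsilon> / 2"
      "L ^ s - \<epsilon> / 2 < (L - \<eta>) ^ s * (1 - \<eta>)" "0 < \<eta>" "\<eta> < L" "\<eta> < 1"
    by (auto dest!: eventually_happens)
  \<comment> \<open>Below, T is at most 2 \<open>\<delta>\<close> n and m - T at least n/4, so their
    ratio is at most 8 \<open>\<delta>\<close>; this choice makes the truncation loss at most
    \<open>\<eta>\<close>. The cap 1/8 is what keeps T below n/4.\<close>
  define \<delta> where "\<delta> = min (1/8) ((\<eta> / C) ^ s / 8)"
  have \<delta>: "\<delta> > 0" "\<delta> \<le> 1/8" using \<eta> C by (auto simp: \<delta>_def)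
  have "C * (8 * \<delta>) powr (1 / real s) \<le> C * ((\<eta> / C) ^ s) powr (1 / real s)"
    using \<delta> C by (intro mult_left_mono powr_mono2) (auto simp: \<delta>_def)
  also have "((\<eta> / C) ^ s) powr (1 / real s) = \<eta> / C"
    using assms \<eta> C by (subst powr_realpow[symmetric]) (auto simp: powr_powr)
  finally have C\<delta>: "C * (8 * \<delta>) powr (1 / real s) \<le> \<eta>" using C by simp
  define D where "D = \<delta> powr e"
  define T where "T = (\<lambda>n. nat \<lceil>\<delta> * real n\<rceil>)"
  have "(\<lambda>n. p n / G $ n) \<longlonglongrightarrow> L"
    unfolding p_def G_def L_def using assms by (intro pseudo_power_prob_asymptotic)
  then have "\<forall>\<^sub>F n in sequentially. dist (p n / G $ n) L < \<eta>" using \<eta>(3) by (rule tendstoD)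
  then obtain N where N: "\<And>n. n \<ge> N \<Longrightarrow> dist (p n / G $ n) L < \<eta>"
    by (auto simp: eventually_sequentially)
  have pG: "(L - \<eta>) * G $ n \<le> p n" "p n \<le> (L + \<eta>) * G $ n" if "n \<ge> N" for n
  proof -
    have "L - \<eta> \<le> p n / G $ n" "p n / G $ n \<le> L + \<eta>" using N[OF that] by (auto simp: dist_real_def)
    then show "(L - \<eta>) * G $ n \<le> p n" "p n \<le> (L + \<eta>) * G $ n"
      using G[of n] by (auto simp: field_simps)
  qed
  \<comment> \<open>Bounds the contribution of lists with repeated entries, using m + 1 at most 2n.
    The exponents add up to s - 2 + s e = -1, so it vanishes.\<close>
  define err where "err = (\<lambda>n. real (s\<^sup>2) * (2 * real n) ^ (s - 2) * (D * real n powr e) ^ s)"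
  have "\<forall>\<^sub>F n in sequentially. real (s\<^sup>2) * 2 ^ (s - 2) * D ^ s * real n powr (-1) = err n"
    using eventually_gt_at_top[of 0]
  proof eventually_elim
    case (elim n)
    have "real (s - 2) + e * real s = -1" using assms by (simp add: e_def field_simps of_nat_diff)
    then have "(2 * real n) ^ (s - 2) * (D * real n powr e) ^ s = 2 ^ (s - 2) * D ^ s * real n powr (-1)"
      using elim power_mult_powr_power[of "real n" 2 "s - 2" D e s] by simp
    then show ?case by (simp only: err_def mult.assoc)
  qed
  moreover have "(\<lambda>n. real (s\<^sup>2) * 2 ^ (s - 2) * D ^ s * real n powr (-1)) \<longlonglongrightarrow> 0"
    by (rule tendsto_mult_right_zero) real_asymp
  ultimately have "err \<longlonglongrightarrow> 0" by (rule Lim_transform_eventually[rotated])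
  then have err: "\<forall>\<^sub>F n in sequentially. err n < \<epsilon> / 2" using assms by (intro order_tendstoD) auto
  have large: "\<forall>\<^sub>F n in sequentially. \<delta> * real n \<ge> real (N + 1)"
  proof -
    have "filterlim (\<lambda>n. \<delta> * real n) at_top sequentially"
      by (rule filterlim_tendsto_pos_mult_at_top[OF tendsto_const \<delta>(1) filterlim_real_sequentially])
    then show ?thesis by (simp add: filterlim_at_top)
  qed
  have "\<forall>\<^sub>F n in sequentially. \<forall>m. n \<le> 2 * m \<longrightarrow> m \<le> n \<longrightarrow>
     \<bar>(\<Sum>X\<in>sum_sets (T n) s m. \<Prod>x\<in>X. p x) - pseudo_power_lambda s\<bar> \<le> \<epsilon>"
    using err large eventually_gt_at_top[of 0]
  proof eventually_elim
    case (elim n)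
    show ?case
    proof (intro allI impI)
      fix m assume m: "n \<le> 2 * m" "m \<le> n"
      define P where "P = Abs_fps (\<lambda>k. if k < T n then 0 else p k)"
      define R where "R = (\<Sum>X\<in>sum_sets (T n) s m. \<Prod>x\<in>X. p x)"
      \<comment> \<open>Rounding up at most doubles \<open>\<delta> * real n\<close>, which is at
        least 1 by the choice of n.\<close>
      have T: "\<delta> * real n \<le> real (T n)" "real (T n) \<le> 2 * (\<delta> * real n)"
        using elim(2) \<delta> by (auto simp: T_def) linarith+
      have TN: "T n \<ge> N" "T n \<ge> 1" using T(1) elim(2) by linarith+
      have P0: "P $ k \<ge> 0" for k by (simp add: P_def p_def pseudo_power_prob_nonneg)
      have "P $ k \<le> (fps_const (L + \<eta>) * v (T n)) $ k" for k
        using pG(2)[of k] TN by (auto simp: P_def v0)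
      then have "(P ^ s) $ m \<le> ((fps_const (L + \<eta>) * v (T n)) ^ s) $ m"
        by (intro fps_power_mono_nth P0)
      also have "\<dots> = (L + \<eta>) ^ s * (v (T n) ^ s) $ m"
        by (simp add: power_mult_distrib fps_const_power)
      also have "\<dots> \<le> (L + \<eta>) ^ s * 1"
        using L \<eta> by (intro mult_left_mono v1) auto
      finally have up: "(P ^ s) $ m \<le> L ^ s + \<epsilon> / 2" using \<eta>(1) by simp
      have mT: "T n < m" "real n / 4 \<le> real (m - T n)"
      proof -
        have "\<delta> * real n \<le> 1/8 * real n" using \<delta> by (intro mult_right_mono) auto
        moreover have "real n \<le> 2 * real m" using m(1) by linarith
        ultimately have "real (T n) + real n / 4 \<le> real m" using T by linarith
        then show "T n < m" "real n / 4 \<le> real (m - T n)" using elim(3) by (auto simp: of_nat_diff)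
      qed
      have "real (T n) / real (m - T n) \<le> (2 * (\<delta> * real n)) / (real n / 4)"
        using T mT elim(3) \<delta> by (intro frac_le) auto
      then have "real (T n) / real (m - T n) \<le> 8 * \<delta>" using elim(3) by simp
      then have "C * (real (T n) / real (m - T n)) powr (1 / real s) \<le> C * (8 * \<delta>) powr (1 / real s)"
        using C(1) by (intro mult_left_mono powr_mono2) auto
      then have "1 - \<eta> \<le> (v (T n) ^ s) $ m" using C(2)[OF TN(2) mT(1)] C\<delta> by linarith
      then have "(L - \<eta>) ^ s * (1 - \<eta>) \<le> (L - \<eta>) ^ s * (v (T n) ^ s) $ m"
        using \<eta> by (intro mult_left_mono) auto
      also have "\<dots> = ((fps_const (L - \<eta>) * v (T n)) ^ s) $ m"
        by (simp add: power_mult_distrib fps_const_power)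
      also have "\<dots> \<le> (P ^ s) $ m"
      proof (rule fps_power_mono_nth)
        show "(fps_const (L - \<eta>) * v (T n)) $ k \<le> P $ k" for k
          using pG(1)[of k] TN by (auto simp: P_def v0)
        show "0 \<le> (fps_const (L - \<eta>) * v (T n)) $ k" for k
          using \<eta> G[of k] by (auto simp: v0)
      qed
      finally have lo: "L ^ s - \<epsilon> / 2 \<le> (P ^ s) $ m" using \<eta>(2) by linarith
      have pB: "p k \<le> D * real n powr e" if "T n \<le> k" for k
      proof -
        have "p k \<le> (\<delta> * real n) powr e" unfolding p_def e_def
          using T(1) that assms \<delta> elim(3) by (intro pseudo_power_prob_le_powr) auto
        then show ?thesis using \<delta> by (simp add: D_def powr_mult)
      qed
      note bds = sum_sum_sets_bounds[of s p "T n" "D * real n powr e" m, folded P_def R_def]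
      have "fact s * R \<le> (P ^ s) $ m"
        using assms pB by (intro bds) (auto simp: p_def pseudo_power_prob_nonneg D_def)
      moreover have "(P ^ s) $ m \<le> fact s * R + real (s\<^sup>2 * (m + 1) ^ (s - 2)) * (D * real n powr e) ^ s"
        using assms pB by (intro bds) (auto simp: p_def pseudo_power_prob_nonneg D_def)
      moreover have "real (s\<^sup>2 * (m + 1) ^ (s - 2)) * (D * real n powr e) ^ s \<le> err n"
        unfolding err_def of_nat_mult of_nat_power
        using m elim(3) by (intro mult_right_mono mult_left_mono power_mono) (auto simp: D_def)
      ultimately have "\<bar>fact s * R - L ^ s\<bar> \<le> \<epsilon>" using up lo elim(1) by linarith
      moreover have "fact s * R - L ^ s = fact s * (R - pseudo_power_lambda s)"
        by (simp add: pseudo_power_lambda_eq L_def right_diff_distrib)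
      moreover have "1 * \<bar>R - pseudo_power_lambda s\<bar> \<le> fact s * \<bar>R - pseudo_power_lambda s\<bar>"
        by (intro mult_right_mono) (auto simp: fact_ge_1)
      ultimately show "\<bar>R - pseudo_power_lambda s\<bar> \<le> \<epsilon>"
        unfolding R_def by (simp add: abs_mult)
    qed
  qed
  then show ?thesis using \<delta> unfolding T_def p_def by blast
qed

subsection \<open>Almost sure representability\<close>

text \<open>\<open>pseudo_power_prob s b\<close> is the derivative of x^(1/s) at b, and a concave
  function lies below its tangent. Bernoulli's inequality gives the s-th power of this
  bound.\<close>

lemma powr_Suc_le_add_pseudo_power_prob:
  assumes "s \<ge> 2" "b \<ge> 1"
  shows "real (b + 1) powr (1 / real s) \<le> real b powr (1 / real s) + pseudo_power_prob s b"
proof -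
  have pos: "0 < 1 + 1 / (real s * real b)" using assms by (intro add_pos_nonneg) auto
  have "1 + real s * (1 / (real s * real b)) \<le> (1 + 1 / (real s * real b)) ^ s"
    using assms by (intro Bernoulli_inequality) (auto intro: order_trans[of _ 0])
  then have "real (b + 1) \<le> real b * (1 + 1 / (real s * real b)) ^ s"
    using assms by (simp add: field_simps)
  then have "real (b + 1) powr (1 / real s) \<le> (real b * (1 + 1 / (real s * real b)) ^ s) powr (1 / real s)"
    by (intro powr_mono2) auto
  also have "\<dots> = real b powr (1 / real s) * (1 + 1 / (real s * real b))"
    using assms pos by (simp add: powr_mult powr_realpow[symmetric] powr_powr)
  also have "\<dots> = real b powr (1 / real s) + pseudo_power_prob s b"
  proof -
    have "real b powr (-1 + 1 / real s) = real b powr (1 / real s) / real b"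
      using assms by (simp only: powr_add) (simp add: powr_minus divide_inverse)
    then show ?thesis by (simp add: pseudo_power_prob_def distrib_left)
  qed
  finally show ?thesis .
qed

text \<open>The tangent bounds telescope from b = 1, where b^(1/s) = 1; this is the 1 lost on the
  left.\<close>

lemma sum_pseudo_power_prob_ge:
  assumes "s \<ge> 2" "x \<ge> 0"
  shows "x - 1 \<le> (\<Sum>b | 1 \<le> b \<and> real b < x ^ s. pseudo_power_prob s b)"
proof -
  have ind: "real (M + 1) powr (1 / real s) \<le> 1 + (\<Sum>b=1..M. pseudo_power_prob s b)" for M
  proof (induction M)
    case (Suc M)
    then show ?case using powr_Suc_le_add_pseudo_power_prob[OF assms(1), of "M + 1"] by simp
  qed simp
  \<comment> \<open>The largest integer strictly below \<open>x ^ s\<close>, or 0 when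
    \<open>x = 0\<close>, where the subtraction truncates.\<close>
  define M where "M = nat \<lceil>x ^ s\<rceil> - 1"
  have "x ^ s \<le> real (M + 1)" unfolding M_def by linarith
  then have "(x ^ s) powr (1 / real s) \<le> real (M + 1) powr (1 / real s)"
    using assms by (intro powr_mono2) auto
  moreover have "(x ^ s) powr (1 / real s) = x"
    using assms by (cases "x = 0") (auto simp: powr_realpow[symmetric] powr_powr)
  moreover have "{b. 1 \<le> b \<and> real b < x ^ s} = {1..M}"
  proof (intro set_eqI iffI)
    fix b assume "b \<in> {1..M}"
    then have "int b < \<lceil>x ^ s\<rceil>" "1 \<le> b" unfolding M_def by auto
    then show "b \<in> {b. 1 \<le> b \<and> real b < x ^ s}" by (simp add: less_ceiling_iff)
  next
    fix b assume "b \<in> {b. 1 \<le> b \<and> real b < x ^ s}"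
    then have "int b < \<lceil>x ^ s\<rceil>" "1 \<le> b" by (auto simp: less_ceiling_iff)
    then show "b \<in> {1..M}" unfolding M_def by auto
  qed
  ultimately show ?thesis using ind[of M] by simp
qed

section \<open>The failure probability for a fixed n\<close>

context pseudo_powers
begin

lemma
  shows indep_events_random_set: "indep_events (\<lambda>i. {\<omega> \<in> space M. i \<in> random_set xi \<omega>}) {1..}"
    and prob_random_set: "prob {\<omega> \<in> space M. i \<in> random_set xi \<omega>} = pseudo_power_prob s i"
proof -
  have "indep_events (\<lambda>i. {\<omega> \<in> space M. i \<ge> 1 \<and> xi i \<omega> = 1}) {1..}"
    using indep_eventsI_indep_vars[OF indep_xi, of "\<lambda>i x. i \<ge> 1 \<and> x = 1"] by simp
  then show "indep_events (\<lambda>i. {\<omega> \<in> space M. i \<in> random_set xi \<omega>}) {1..}"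
    by (simp add: random_set_def)
  show "prob {\<omega> \<in> space M. i \<in> random_set xi \<omega>} = pseudo_power_prob s i"
    using prob_xi_1[of i] by (cases "i \<ge> 1") (auto simp: random_set_def pseudo_power_prob_def)
qed

text \<open>Janson's inequality for the sets \<open>insert b X\<close>. Each \<open>b\<close> adds
  \<open>p b * R b\<close> to the expectation and at most \<open>p b * (R b)\<^sup>2 / 2\<close> to
  the correction from pairs sharing \<open>b\<close>, a net gain of at least
  \<open>p b * (l - h\<^sup>2 / 2)\<close>; the term with \<open>\<beta>\<close> collects the pairs
  whose \<open>X\<close> parts meet.\<close>

lemma prob_no_representation_le:
  fixes n :: nat
  assumes "s \<ge> 2" and B: "finite B" "\<And>b. b \<in> B \<Longrightarrow> 1 \<le> b \<and> b < T \<and> b \<le> n" and "\<beta> \<ge> 0"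
    and \<beta>: "\<And>k j. 1 \<le> k \<Longrightarrow> k < s \<Longrightarrow> j \<le> n \<Longrightarrow>
      (\<Sum>Z\<in>sum_sets T k j. \<Prod>x\<in>Z. pseudo_power_prob s x) \<le> \<beta>"
    and R: "\<And>b. b \<in> B \<Longrightarrow> (\<Sum>X\<in>sum_sets T s (n - b). \<Prod>x\<in>X. pseudo_power_prob s x) \<in> {l..h}"
    and "0 \<le> l"
  defines "Q \<equiv> {\<omega>\<in>space M. \<forall>b\<in>B. \<forall>X\<in>sum_sets T s (n - b). \<not> insert b X \<subseteq> random_set xi \<omega>}"
  shows "Q \<in> events"
    and "prob Q \<le> exp (- (\<Sum>b\<in>B. pseudo_power_prob s b) * (l - h\<^sup>2 / 2) + (real (card B))\<^sup>2 * (2 ^ s * \<beta>) * h / 2)"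
proof -
  define p where "p = pseudo_power_prob s"
  define K where "K = Sigma B (\<lambda>b. sum_sets T s (n - b))"
  define F :: "nat \<times> nat set \<Rightarrow> nat set" where "F = (\<lambda>(b, X). insert b X)"
  define E where "E = (\<lambda>i. {\<omega> \<in> space M. i \<in> random_set xi \<omega>})"
  define R where "R = (\<lambda>b. \<Sum>X\<in>sum_sets T s (n - b). prod p X)"
  have E: "indep_events E {1..}" unfolding E_def by (rule indep_events_random_set)
  have pE: "prob (E i) = p i" for i by (simp add: E_def p_def prob_random_set)
  have p: "0 \<le> p x" "p x \<le> 1" for x
    using assms(1) by (auto simp: p_def pseudo_power_prob_nonneg pseudo_power_prob_le_1)
  have finK: "finite K" using B by (auto simp: K_def)
  have F: "finite (F x) \<and> F x \<subseteq> {1..}" if "x \<in> K" for x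
  proof -
    obtain b X where x: "x = (b, X)" by (cases x)
    then have "b \<in> B" "X \<in> sum_sets T s (n - b)" using that by (auto simp: K_def)
    then show ?thesis using B(2)[of b] by (force simp: x F_def sum_sets_def)
  qed
  have Q_eq: "Q = {\<omega>\<in>space M. \<forall>x\<in>K. \<not> (\<forall>i\<in>F x. \<omega> \<in> E i)}"
    by (auto simp: Q_def K_def F_def E_def)
  show "Q \<in> events"
    unfolding Q_eq using events_Ball_not_Ball[OF E finK, of "{}" F] F by simp
  have Rb: "R b \<in> {l..h}" if "b \<in> B" for b
    using assms(6)[OF that] by (simp add: R_def p_def)
  have B': "b < T \<and> b \<le> n" if "b \<in> B" for b using B(2)[OF that] by simp
  have \<beta>': "(\<Sum>Z\<in>sum_sets T k j. prod p Z) \<le> \<beta>" if "1 \<le> k" "k < s" "j \<le> n" for k j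
    using \<beta>[OF that] by (simp add: p_def)
  have 1: "(\<Sum>x\<in>K. prod p (F x)) = (\<Sum>b\<in>B. p b * R b)"
    unfolding K_def F_def R_def
    by (rule sum_prod_insert_sum_sets[OF p B(1) B' \<open>\<beta> \<ge> 0\<close> \<beta>'])
  have 2: "(\<Sum>x\<in>K. \<Sum>y | y \<in> K \<and> y \<noteq> x \<and> F x \<inter> F y \<noteq> {}. prod p (F x \<union> F y))
        \<le> (\<Sum>b\<in>B. p b * (R b)\<^sup>2) + real (card B) * (2 ^ s * \<beta>) * (\<Sum>b\<in>B. R b)"
    unfolding K_def F_def R_def
    by (rule sum_prod_overlapping_insert_sum_sets[OF p B(1) B' \<open>\<beta> \<ge> 0\<close> \<beta>'])
  have "(\<Sum>b\<in>B. R b) \<le> (\<Sum>b\<in>B. h)" using Rb by (intro sum_mono) auto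
  then have "real (card B) * (2 ^ s * \<beta>) * (\<Sum>b\<in>B. R b) \<le> real (card B) * (2 ^ s * \<beta>) * (real (card B) * h)"
    using \<open>\<beta> \<ge> 0\<close> by (intro mult_left_mono) auto
  also have "\<dots> = (real (card B))\<^sup>2 * (2 ^ s * \<beta>) * h" by (simp add: power2_eq_square)
  finally have 3: "real (card B) * (2 ^ s * \<beta>) * (\<Sum>b\<in>B. R b) \<le> (real (card B))\<^sup>2 * (2 ^ s * \<beta>) * h" .
  have "(\<Sum>b\<in>B. p b * (l - h\<^sup>2 / 2)) \<le> (\<Sum>b\<in>B. p b * (R b - (R b)\<^sup>2 / 2))"
  proof (intro sum_mono mult_left_mono p)
    fix b assume "b \<in> B"
    then have "l \<le> R b" "(R b)\<^sup>2 \<le> h\<^sup>2" using Rb[of b] \<open>0 \<le> l\<close> by (auto intro!: power_mono)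
    then show "l - h\<^sup>2 / 2 \<le> R b - (R b)\<^sup>2 / 2" by simp
  qed
  then have 4: "(\<Sum>b\<in>B. p b) * (l - h\<^sup>2 / 2) \<le> (\<Sum>b\<in>B. p b * R b) - (\<Sum>b\<in>B. p b * (R b)\<^sup>2) / 2"
    by (simp add: sum_distrib_right sum_divide_distrib sum_subtractf right_diff_distrib)
  have "prob Q \<le> exp (- (\<Sum>x\<in>K. prod p (F x)) +
      (\<Sum>x\<in>K. \<Sum>y | y \<in> K \<and> y \<noteq> x \<and> F x \<inter> F y \<noteq> {}. prod p (F x \<union> F y)) / 2)"
    using Janson_inequality[OF E finK, of F] F unfolding Q_eq pE by simp
  also have "\<dots> \<le> exp (- (\<Sum>b\<in>B. p b) * (l - h\<^sup>2 / 2) + (real (card B))\<^sup>2 * (2 ^ s * \<beta>) * h / 2)"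
    unfolding exp_le_cancel_iff mult_minus_left using 1 2 3 4 by linarith
  finally show "prob Q \<le> exp (- (\<Sum>b\<in>B. pseudo_power_prob s b) * (l - h\<^sup>2 / 2) + (real (card B))\<^sup>2 * (2 ^ s * \<beta>) * h / 2)"
    by (simp add: p_def)
qed

end

section \<open>Choice of parameters and summation over all n\<close>

lemma card_less_real_le:
  assumes "x \<ge> 0"
  shows "finite {b::nat. 1 \<le> b \<and> real b < x}" "real (card {b::nat. 1 \<le> b \<and> real b < x}) \<le> x"
proof -
  have sub: "{b::nat. 1 \<le> b \<and> real b < x} \<subseteq> {1..nat \<lfloor>x\<rfloor>}"
    using assms by (auto simp: le_nat_iff le_floor_iff)
  show "finite {b::nat. 1 \<le> b \<and> real b < x}" by (rule finite_subset[OF sub]) simp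
  have "card {b::nat. 1 \<le> b \<and> real b < x} \<le> nat \<lfloor>x\<rfloor>" using card_mono[OF _ sub] by simp
  then show "real (card {b::nat. 1 \<le> b \<and> real b < x}) \<le> x" using assms by linarith
qed

lemma sum_set_eq_tuple:
  fixes X :: "nat set"
  assumes "finite X"
  obtains a :: "nat \<Rightarrow> nat" where "\<forall>i\<in>{1..card X}. a i \<in> X" "(\<Sum>i=1..card X. a i) = \<Sum>X"
proof -
  obtain a where a: "bij_betw a {1..card X} X"
    using finite_same_card_bij[of "{1..card X}" X] assms by auto
  show ?thesis
    using bij_betw_apply[OF a] sum.reindex_bij_betw[OF a, of "\<lambda>x. x"] by (intro that[of a]) auto
qed

theorem theorem1:
  fixes M :: "'w measure" and s :: nat and c :: real and xi :: "nat \<Rightarrow> 'w \<Rightarrow> real"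
  assumes "s \<ge> 2"
    and "c > inverse (pseudo_power_lambda s * (1 - 2 * pseudo_power_lambda s))"
    and "pseudo_powers M s xi"
  shows "AE \<omega> in M. \<exists>N::nat. \<forall>n\<ge>N. \<exists>a :: nat \<Rightarrow> nat.
           (\<forall>i\<in>{1..s+1}. a i \<in> random_set xi \<omega>) \<and>
           n = (\<Sum>i=1..s+1. a i) \<and>
           real (a (s+1)) < (c * ln (real n)) ^ s"
proof -
  interpret pseudo_powers M s xi by fact
  define \<Lambda> where "\<Lambda> = pseudo_power_lambda s"
  have \<Lambda>: "0 < \<Lambda>" "\<Lambda> < 1 / 2"
    unfolding \<Lambda>_def by (rule pseudo_power_lambda_pos[OF assms(1)] pseudo_power_lambda_less[OF assms(1)])+
  then have pos: "\<Lambda> * (1 - 2 * \<Lambda>) > 0" by simp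
  have "inverse (\<Lambda> * (1 - 2 * \<Lambda>)) < c" using assms(2) by (simp add: \<Lambda>_def)
  moreover from this have "c > 0" using pos by (meson less_trans positive_imp_inverse_positive)
  ultimately have "1 < c * (\<Lambda> * (1 - 2 * \<Lambda>))" using pos by (simp add: field_simps)
  \<comment> \<open>The exponent obtained from Janson's inequality is at least the quantity in the
    hypothesis on \<open>c\<close>, because \<open>\<Lambda> - 2 * \<Lambda>\<^sup>2\<close> is at
    most \<open>\<Lambda> - \<Lambda>\<^sup>2 / 2\<close>.\<close>
  also have "\<dots> \<le> c * (\<Lambda> - \<Lambda>\<^sup>2 / 2)"
    using \<open>c > 0\<close> by (intro mult_left_mono) (auto simp: power2_eq_square algebra_simps)
  finally have c: "1 < c * (\<Lambda> - \<Lambda>\<^sup>2 / 2)" .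
  \<comment> \<open>The expected counts are known only up to \<open>\<epsilon>\<close>. The
    inequality is strict, so a small enough \<open>\<epsilon>\<close> keeps the exponent of n above
    1.\<close>
  have "\<forall>\<^sub>F \<epsilon> in at_right 0. 1 < c * ((\<Lambda> - \<epsilon>) - (\<Lambda> + \<epsilon>)\<^sup>2 / 2)"
    by (rule order_tendstoD) (use c in \<open>auto intro!: tendsto_eq_intros\<close>)
  moreover have "\<forall>\<^sub>F \<epsilon> in at_right 0. \<epsilon> \<in> {0<..<\<Lambda>}"
    using \<Lambda> by (intro eventually_at_right_real) auto
  ultimately have "\<forall>\<^sub>F \<epsilon> in at_right 0. 1 < c * ((\<Lambda> - \<epsilon>) - (\<Lambda> + \<epsilon>)\<^sup>2 / 2) \<and> \<epsilon> \<in> {0<..<\<Lambda>}"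
    by eventually_elim auto
  then obtain \<epsilon> where \<epsilon>: "1 < c * ((\<Lambda> - \<epsilon>) - (\<Lambda> + \<epsilon>)\<^sup>2 / 2)" "0 < \<epsilon>" "\<epsilon> < \<Lambda>"
    by (auto dest!: eventually_happens)
  define l h \<kappa> where "l = \<Lambda> - \<epsilon>" and "h = \<Lambda> + \<epsilon>" and "\<kappa> = l - h\<^sup>2 / 2"
  have \<kappa>: "1 < c * \<kappa>" using \<epsilon> by (simp add: l_def h_def \<kappa>_def)
  then have "\<kappa> > 0" using \<open>c > 0\<close> by (metis less_trans zero_less_one zero_less_mult_pos)
  obtain \<delta> where \<delta>: "0 < \<delta>" "\<delta> \<le> 1/8" and asymp: "\<forall>\<^sub>F n in sequentially. \<forall>m. n \<le> 2 * m \<longrightarrow> m \<le> n \<longrightarrow>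
     \<bar>(\<Sum>X\<in>sum_sets (nat \<lceil>\<delta> * real n\<rceil>) s m. \<Prod>x\<in>X. pseudo_power_prob s x) - \<Lambda>\<bar> \<le> \<epsilon>"
    using sum_sum_sets_pseudo_power_prob_asymptotic[OF assms(1) \<epsilon>(2)] unfolding \<Lambda>_def by blast
  define T where "T = (\<lambda>n. nat \<lceil>\<delta> * real n\<rceil>)"
  define \<beta> where "\<beta> = (\<lambda>n. (2 * \<delta> powr (-1 + 1 / real s)) ^ s * real n powr (- 1 / real s))"
  define B where "B = (\<lambda>n. {b::nat. 1 \<le> b \<and> real b < (c * ln (real n)) ^ s})"
  define Q where "Q = (\<lambda>n. {\<omega>\<in>space M. \<forall>b\<in>B n. \<forall>X\<in>sum_sets (T n) s (n - b). \<not> insert b X \<subseteq> random_set xi \<omega>})"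
  have lim: "(\<lambda>n. (ln (real n)) ^ k * real n powr (- a)) \<longlonglongrightarrow> 0" if "a > 0" for k and a :: real
    using that by real_asymp
  \<comment> \<open>Gives \<open>b < T n\<close>, as the separation of \<open>b\<close> from
    \<open>X\<close> requires, and b at most n/8, so that n - b stays in the range where
    \<open>asymp\<close> applies.\<close>
  have small: "\<forall>\<^sub>F n in sequentially. (c * ln (real n)) ^ s < \<delta> * real n"
  proof -
    have "(\<lambda>n. c ^ s * ((ln (real n)) ^ s * real n powr (- 1))) \<longlonglongrightarrow> 0"
      by (intro tendsto_mult_right_zero lim) simp
    then have "\<forall>\<^sub>F n in sequentially. c ^ s * ((ln (real n)) ^ s * real n powr (- 1)) < \<delta>"
      using \<delta> by (intro order_tendstoD) auto
    then show ?thesis using eventually_gt_at_top[of 0]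
      by eventually_elim (simp add: powr_minus field_simps power_mult_distrib)
  qed
  \<comment> \<open>After halving, the overlap term adds at most 1 to the exponent.\<close>
  have err: "\<forall>\<^sub>F n in sequentially. ((c * ln (real n)) ^ s)\<^sup>2 * (2 ^ s * \<beta> n) * h < 2"
  proof -
    define C where "C = (c ^ s)\<^sup>2 * (2 ^ s * (2 * \<delta> powr (-1 + 1 / real s)) ^ s) * h"
    have "(\<lambda>n. C * ((ln (real n)) ^ (s * 2) * real n powr (- (1 / real s)))) \<longlonglongrightarrow> 0"
      using assms(1) by (intro tendsto_mult_right_zero lim) simp
    then have "\<forall>\<^sub>F n in sequentially. C * ((ln (real n)) ^ (s * 2) * real n powr (- (1 / real s))) < 2"
      by (intro order_tendstoD) auto
    then show ?thesis by (simp add: C_def \<beta>_def power_mult_distrib power_mult mult_ac)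
  qed
  \<comment> \<open>In the constant \<open>exp (\<kappa> + 1)\<close>, the \<open>\<kappa>\<close>
    pays for the 1 lost in \<open>sum_pseudo_power_prob_ge\<close> and the 1 for the overlap
    term.\<close>
  have "\<forall>\<^sub>F n in sequentially. Q n \<in> events \<and> prob (Q n) \<le> exp (\<kappa> + 1) * real n powr (- (c * \<kappa>))
      \<and> (\<forall>b\<in>B n. b \<le> n)"
    using asymp small err eventually_gt_at_top[of 0]
  proof eventually_elim
    case (elim n)
    have ln: "0 \<le> c * ln (real n)" using \<open>c > 0\<close> elim(4) by simp
    have fin: "finite (B n)" and card: "real (card (B n)) \<le> (c * ln (real n)) ^ s"
      unfolding B_def using ln by (intro card_less_real_le; simp)+
    have T: "\<delta> * real n \<le> real (T n)" unfolding T_def by linarith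
    have b: "1 \<le> b \<and> b < T n \<and> 2 * b \<le> n" if "b \<in> B n" for b
    proof -
      have "1 \<le> b" "real b < \<delta> * real n" using that elim(2) by (auto simp: B_def)
      moreover have "\<delta> * real n \<le> 1/8 * real n" using \<delta> by (intro mult_right_mono) auto
      ultimately show ?thesis using T by auto
    qed
    have R: "(\<Sum>X\<in>sum_sets (T n) s (n - b). \<Prod>x\<in>X. pseudo_power_prob s x) \<in> {l..h}" if "b \<in> B n" for b
    proof -
      have "n \<le> 2 * (n - b)" "n - b \<le> n" using b[OF that] by auto
      then have "\<bar>(\<Sum>X\<in>sum_sets (T n) s (n - b). \<Prod>x\<in>X. pseudo_power_prob s x) - \<Lambda>\<bar> \<le> \<epsilon>"
        using elim(1) unfolding T_def by blast
      then show ?thesis by (auto simp: l_def h_def abs_le_iff)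
    qed
    have \<beta>: "(\<Sum>Z\<in>sum_sets (T n) k j. \<Prod>x\<in>Z. pseudo_power_prob s x) \<le> \<beta> n"
      if "1 \<le> k" "k < s" "j \<le> n" for k j
      unfolding \<beta>_def using assms(1) \<delta> T that elim(4)
      by (intro sum_sum_sets_pseudo_power_prob_le) auto
    have \<beta>0: "\<beta> n \<ge> 0" by (simp add: \<beta>_def)
    have B': "1 \<le> b \<and> b < T n \<and> b \<le> n" if "b \<in> B n" for b using b[OF that] by simp
    have l0: "0 \<le> l" using \<epsilon> by (simp add: l_def)
    note bound = prob_no_representation_le[OF assms(1) fin B' \<beta>0 \<beta> R l0, folded Q_def]
    have "Q n \<in> events" using bound(1) by (simp add: Q_def)
    moreover have "prob (Q n) \<le> exp (\<kappa> + 1) * real n powr (- (c * \<kappa>))"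
    proof -
      have "prob (Q n) \<le> exp (- (\<Sum>b\<in>B n. pseudo_power_prob s b) * \<kappa> + (real (card (B n)))\<^sup>2 * (2 ^ s * \<beta> n) * h / 2)"
        using bound(2) by (simp add: Q_def \<kappa>_def)
      also have "\<dots> \<le> exp (- (c * ln (real n) - 1) * \<kappa> + 1)"
      proof -
        have "(c * ln (real n) - 1) * \<kappa> \<le> (\<Sum>b\<in>B n. pseudo_power_prob s b) * \<kappa>"
          unfolding B_def using ln \<open>\<kappa> > 0\<close> assms(1)
          by (intro mult_right_mono sum_pseudo_power_prob_ge) auto
        moreover have "(real (card (B n)))\<^sup>2 * (2 ^ s * \<beta> n) * h \<le> ((c * ln (real n)) ^ s)\<^sup>2 * (2 ^ s * \<beta> n) * h"
          using card \<beta>0 \<epsilon> \<Lambda> by (intro mult_right_mono power_mono) (auto simp: h_def)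
        ultimately show ?thesis
          unfolding exp_le_cancel_iff mult_minus_left using elim(3) by linarith
      qed
      also have "- (c * ln (real n) - 1) * \<kappa> + 1 = (\<kappa> + 1) + - (c * \<kappa>) * ln (real n)"
        by (simp add: algebra_simps)
      also have "exp \<dots> = exp (\<kappa> + 1) * real n powr (- (c * \<kappa>))"
        using elim(4) unfolding exp_add[of "\<kappa> + 1"] by (simp add: powr_def)
      finally show ?thesis .
    qed
    ultimately show ?case using B' by blast
  qed
  then obtain N where N: "\<And>n. n \<ge> N \<Longrightarrow> Q n \<in> events"
      "\<And>n. n \<ge> N \<Longrightarrow> prob (Q n) \<le> exp (\<kappa> + 1) * real n powr (- (c * \<kappa>))"
      "\<And>n b. n \<ge> N \<Longrightarrow> b \<in> B n \<Longrightarrow> b \<le> n"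
    unfolding eventually_sequentially by blast
  \<comment> \<open>Borel--Cantelli asks for measurability at every index, whereas
    \<open>Q n\<close> has been treated only from \<open>N\<close> on.\<close>
  define Q' where "Q' = (\<lambda>n. if n \<ge> N then Q n else {})"
  have "AE \<omega> in M. \<forall>\<^sub>F n in sequentially. \<omega> \<in> space M - Q' n"
  proof (rule borel_cantelli_AE1)
    show "Q' n \<in> events" for n using N(1) by (simp add: Q'_def)
    show "emeasure M (Q' n) < \<infinity>" for n by (simp add: emeasure_eq_measure)
    have "summable (\<lambda>n. exp (\<kappa> + 1) * real n powr (- (c * \<kappa>)))"
      using \<kappa> by (intro summable_mult) (simp add: summable_real_powr_iff)
    then show "summable (\<lambda>n. prob (Q' n))"
      by (rule summable_comparison_test'[of _ N]) (use N(2) in \<open>simp add: Q'_def\<close>)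
  qed
  then show ?thesis
  proof eventually_elim
    case (elim \<omega>)
    then obtain N' where N': "\<And>n. n \<ge> N' \<Longrightarrow> \<omega> \<in> space M - Q' n"
      unfolding eventually_sequentially by blast
    show ?case
    proof (intro exI[of _ "max N N'"] allI impI)
      fix n assume n: "n \<ge> max N N'"
      then have "\<omega> \<in> space M - Q n" using N'[of n] by (simp add: Q'_def)
      then obtain b X where bX: "b \<in> B n" "X \<in> sum_sets (T n) s (n - b)" "insert b X \<subseteq> random_set xi \<omega>"
        by (auto simp: Q_def)
      have X: "finite X" "card X = s" "\<Sum>X = n - b" using bX(2) by (auto simp: sum_sets_def)
      obtain a where a: "\<forall>i\<in>{1..s}. a i \<in> X" "(\<Sum>i=1..s. a i) = n - b"
        using sum_set_eq_tuple[OF X(1)] X by metis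
      \<comment> \<open>The elements of \<open>X\<close> fill the first s places and the small
        summand \<open>b\<close> goes last; \<open>b \<le> n\<close> makes the subtraction in
        \<open>n - b + b\<close> exact.\<close>
      have "(\<Sum>i=1..s. (a(s + 1 := b)) i) = (\<Sum>i=1..s. a i)" by (intro sum.cong) auto
      then have "(\<Sum>i=1..s+1. (a(s + 1 := b)) i) = n - b + b" using a by simp
      moreover have "b \<le> n" using N(3) n bX(1) by simp
      moreover have "(a(s + 1 := b)) i \<in> random_set xi \<omega>" if "i \<in> {1..s+1}" for i
        using a(1) bX(3) that by (cases "i = s + 1") auto
      ultimately show "\<exists>a. (\<forall>i\<in>{1..s+1}. a i \<in> random_set xi \<omega>) \<and> n = (\<Sum>i=1..s+1. a i) \<and>
           real (a (s+1)) < (c * ln (real n)) ^ s"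
        using bX(1) by (intro exI[of _ "a(s + 1 := b)"]) (simp add: B_def)
    qed
  qed
qed

end
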